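(* Let $\alpha\in(0,1)$ and $\beta\in(0,1-\alpha)$ be fixed with $\alpha+\beta\le0.59$, let $0<p<2$, $R>0$, let $a=(a_j)_{j\in J}$ be a monotone non-decreasing sequence of positive numbers, and let $$\mathcal{E}_{a,p}(R)=\Bigl\{\nu\in l_2(J):\ \sum_{j\in J}a_j^p|\nu_j|^p\le R^p\Bigr\}.$$ For $D\in J$ let $\sigma_{(1)}\le\dots\le\sigma_{(D)}$ be the values $\sigma_1,\dots,\sigma_D$ arranged in non-decreasing order, and for $0\le l\le D-\lceil\sqrt D\rceil$ set $$\Sigma_{l,\lceil\sqrt D\rceil}^2=\sum_{j=l+1}^{l+\lceil\sqrt D\rceil}\sigma_{(j)}^2,\qquad \rho^2_{\lceil\sqrt D\rceil,D,l}=\Sigma_{l,\lceil\sqrt D\rceil}^2\,\ln\Bigl(1+\sqrt{1-\frac lD}\Bigr).$$ Then $$\rho_2^2(\mathcal{E}_{a,p}(R),\alpha,\beta)\ge\sup_{D\in J}\bigl(r_1(D)\vee r_2(D)\bigr),$$ where $$r_1(D)=\max_{0\le l\le D-\lceil\sqrt D\rceil}\Bigl((\sqrt D)^{1-2/p}R^2a_D^{-2}\,\frac{\Sigma_{l,\lceil\sqrt D\rceil}^2}{\Sigma_{D-\lceil\sqrt D\rceil,\lceil\sqrt D\rceil}^2}\ \wedge\ \rho^2_{\lceil\sqrt D\rceil,D,l}\Bigr)$$ and $$r_2(D)=(\sqrt D)^{1-2/p}R^2a_D^{-2}\ \wedge\ \Bigl(\sum_{j=D-\lceil\sqrt D\r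ceil+1}^D\sigma_{(j)}^4\Bigr)^{1/2}.$$
   Context: Model: $J=\{1,\dots,N\}$ for some integer $N\ge1$, or $J=\{1,2,3,\dots\}$. One observes $Y=(Y_j)_{j\in J}$ with $Y_j=\theta_j+\sigma_j\epsilon_j$, where $\theta=(\theta_j)_{j\in J}$ is unknown, $\sigma_j>0$ are known, and $(\epsilon_j)_{j\in J}$ are i.i.d. standard normal. $\mathbb{P}_\theta$ is the distribution of $Y$. $\|\theta\|_2^2=\sum_{j\in J}\theta_j^2$; $x\vee y=\max(x,y)$, $x\wedge y=\min(x,y)$; $\lceil x\rceil=m+1$ where $m$ is the greatest integer (strictly) smaller than $x$. A test is a measurable function $\Phi$ of $Y$ with values in $\{0,1\}$; the null hypothesis "$\theta=0$" is rejected iff $\Phi=1$. It has level $\alpha$ if $\mathbb{P}_0(\Phi=1)\le\alpha$. For $\mathcal{F}\subset l_2(J)$ and a level-$\alpha$ test $\Phi_\alpha$, $\rho_2(\Phi_\alpha,\mathcal{F},\beta)=\inf\{\rho>0:\ \inf_{\theta\in\mathcal{F},\|\theta\|_2\ge\rho}\mathbb{P}_\theta(\Phi_\alpha=1)>1-\beta\}$ (the condition on $\rho$ holds vacuously if no $\theta\in\mathcal{F}$ has $\|\theta\|_2\ge\rho$), and the $(\alpha,\beta)$ minimax rate of testing $\rho_2(\mathcal{F},\alpha,\beta)$ is the infimum of $\rho_2(\Phi_\alpha,\mathcal{F},\beta)$ over all level-$\alpha$ tests. *)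

theory Defs
  imports "HOL-Probability.Probability"
begin

definition observation_law :: "nat set \<Rightarrow> (nat \<Rightarrow> real) \<Rightarrow> (nat \<Rightarrow> real) \<Rightarrow> (nat \<Rightarrow> real) measure" where
  "observation_law J \<sigma> \<theta> =
     distr (\<Pi>\<^sub>M j\<in>J. density lborel std_normal_density) (\<Pi>\<^sub>M j\<in>J. borel)
       (\<lambda>\<epsilon>. \<lambda>j\<in>J. \<theta> j + \<sigma> j * \<epsilon> j)"

text \<open>Families indexed by \<open>J\<close> are functions on \<open>nat\<close> that are \<open>undefined\<close> outside \<open>J\<close>.\<close>

definition l2_space :: "nat set \<Rightarrow> (nat \<Rightarrow> real) set" where
  "l2_space J = {\<theta> \<in> J \<rightarrow>\<^sub>E UNIV. (\<lambda>j. (\<theta> j)\<^sup>2) summable_on J}"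

definition l2_norm :: "nat set \<Rightarrow> (nat \<Rightarrow> real) \<Rightarrow> real" where
  "l2_norm J \<theta> = sqrt (\<Sum>\<^sub>\<infinity>j\<in>J. (\<theta> j)\<^sup>2)"

definition lp_ellipsoid :: "nat set \<Rightarrow> (nat \<Rightarrow> real) \<Rightarrow> real \<Rightarrow> real \<Rightarrow> (nat \<Rightarrow> real) set" where
  "lp_ellipsoid J a p R =
     {\<nu> \<in> l2_space J. (\<lambda>j. a j powr p * \<bar>\<nu> j\<bar> powr p) summable_on J \<and>
        (\<Sum>\<^sub>\<infinity>j\<in>J. a j powr p * \<bar>\<nu> j\<bar> powr p) \<le> R powr p}"

definition tests :: "nat set \<Rightarrow> ((nat \<Rightarrow> real) \<Rightarrow> nat) set" where
  "tests J = measurable (\<Pi>\<^sub>M j\<in>J. borel) (count_space {0, 1})"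

definition rejection_prob ::
    "nat set \<Rightarrow> (nat \<Rightarrow> real) \<Rightarrow> ((nat \<Rightarrow> real) \<Rightarrow> nat) \<Rightarrow> (nat \<Rightarrow> real) \<Rightarrow> real" where
  "rejection_prob J \<sigma> \<Phi> \<theta> =
     measure (observation_law J \<sigma> \<theta>) {y \<in> space (observation_law J \<sigma> \<theta>). \<Phi> y = 1}"

definition level_tests :: "nat set \<Rightarrow> (nat \<Rightarrow> real) \<Rightarrow> real \<Rightarrow> ((nat \<Rightarrow> real) \<Rightarrow> nat) set" where
  "level_tests J \<sigma> \<alpha> = {\<Phi> \<in> tests J. rejection_prob J \<sigma> \<Phi> (\<lambda>j\<in>J. 0) \<le> \<alpha>}"

text \<open>
  The rates are taken in \<open>ereal\<close>. There the infimum over an empty set of alternatives is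
  \<open>\<infinity>\<close>, so the power condition below is then satisfied vacuously.
\<close>

definition test_rate ::
    "nat set \<Rightarrow> (nat \<Rightarrow> real) \<Rightarrow> ((nat \<Rightarrow> real) \<Rightarrow> nat) \<Rightarrow> (nat \<Rightarrow> real) set \<Rightarrow> real \<Rightarrow> ereal" where
  "test_rate J \<sigma> \<Phi> F \<beta> =
     Inf {ereal \<rho> | \<rho>. \<rho> > 0 \<and>
       (INF \<theta>\<in>{\<theta> \<in> F. l2_norm J \<theta> \<ge> \<rho>}. ereal (rejection_prob J \<sigma> \<Phi> \<theta>)) > ereal (1 - \<beta>)}"

definition minimax_rate ::
    "nat set \<Rightarrow> (nat \<Rightarrow> real) \<Rightarrow> (nat \<Rightarrow> real) set \<Rightarrow> real \<Rightarrow> real \<Rightarrow> ereal" where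
  "minimax_rate J \<sigma> F \<alpha> \<beta> = (INF \<Phi>\<in>level_tests J \<sigma> \<alpha>. test_rate J \<sigma> \<Phi> F \<beta>)"

text \<open>\<open>ordered_sd \<sigma> D j\<close> is the \<open>j\<close>-th smallest of \<open>\<sigma> 1, \<dots>, \<sigma> D\<close>, for \<open>1 \<le> j \<le> D\<close>.\<close>

definition ordered_sd :: "(nat \<Rightarrow> real) \<Rightarrow> nat \<Rightarrow> nat \<Rightarrow> real" where
  "ordered_sd \<sigma> D j = sort (map \<sigma> [1..<Suc D]) ! (j - 1)"

definition ceil_sqrt :: "nat \<Rightarrow> nat" where
  "ceil_sqrt D = nat \<lceil>sqrt (real D)\<rceil>"

definition Sigma_sq :: "(nat \<Rightarrow> real) \<Rightarrow> nat \<Rightarrow> nat \<Rightarrow> real" where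
  "Sigma_sq \<sigma> D l = (\<Sum>j = l + 1..l + ceil_sqrt D. (ordered_sd \<sigma> D j)\<^sup>2)"

definition rho_sq :: "(nat \<Rightarrow> real) \<Rightarrow> nat \<Rightarrow> nat \<Rightarrow> real" where
  "rho_sq \<sigma> D l = Sigma_sq \<sigma> D l * ln (1 + sqrt (1 - real l / real D))"

definition r1 :: "(nat \<Rightarrow> real) \<Rightarrow> (nat \<Rightarrow> real) \<Rightarrow> real \<Rightarrow> real \<Rightarrow> nat \<Rightarrow> real" where
  "r1 \<sigma> a p R D =
     (MAX l\<in>{0..D - ceil_sqrt D}.
        min (sqrt (real D) powr (1 - 2 / p) * R\<^sup>2 / (a D)\<^sup>2 *
               (Sigma_sq \<sigma> D l / Sigma_sq \<sigma> D (D - ceil_sqrt D)))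
            (rho_sq \<sigma> D l))"

definition r2 :: "(nat \<Rightarrow> real) \<Rightarrow> (nat \<Rightarrow> real) \<Rightarrow> real \<Rightarrow> real \<Rightarrow> nat \<Rightarrow> real" where
  "r2 \<sigma> a p R D =
     min (sqrt (real D) powr (1 - 2 / p) * R\<^sup>2 / (a D)\<^sup>2)
         (sqrt (\<Sum>j = D - ceil_sqrt D + 1..D. (ordered_sd \<sigma> D j) ^ 4))"

end

theory Submission
  imports Defs "HOL-Combinatorics.Permutations"
begin

text \<open>
  The lower bounds come from the Bayesian argument of the second moment method. If some prior on
  alternatives of norm at least \<open>\<rho>\<close> in the ellipsoid makes the likelihood ratio \<open>L\<close> of the induced
  mixture against the null satisfy \<open>E L\<^sup>2 \<le> 1 + 0.82\<^sup>2\<close>, then no test can have average power exceeding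
  its level by more than \<open>0.41\<close>. Since \<open>1 - \<alpha> - \<beta> \<ge> 0.41\<close>, no level-\<open>\<alpha>\<close> test has rate below \<open>\<rho>\<close>
  (\<open>minimax_rate_ge_of_prior\<close>).

  The membership in the ellipsoid restricts the sparsity: a vector of norm \<open>\<rho>\<close> with \<open>s\<close> nonzero
  entries of any sizes among the first \<open>D\<close> is guaranteed to lie in it if \<open>\<rho>\<^sup>2 \<le> s powr (1 - 2 / p) * R\<^sup>2 / (a D)\<^sup>2\<close>. The rates
  contain \<open>sqrt D\<close> at the place of \<open>s\<close>, so vectors with \<open>k = \<lceil>sqrt D\<rceil>\<close> nonzero entries are too rich
  when \<open>D\<close> is not a square, and the priors have to work with \<open>m = k - 1\<close> entries (\<open>m = 1\<close> if
  \<open>k = 1\<close>), although \<open>k\<close> variances enter the rates.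

  The prior splits a set of coordinates into \<open>m\<close> blocks and puts, independently in each block \<open>i\<close>, a
  value \<open>\<plusminus> c i\<close> at one randomly chosen position. Then \<open>E L\<^sup>2\<close> is a product over blocks. With the
  optimal choice probabilities and \<open>1 / (cosh z - 1) \<ge> 2 / z\<^sup>2 - 1 / 6\<close> (\<open>inverse_cosh_minus_1_ge\<close>) the
  factor of a block of size \<open>n\<close> is at most \<open>1 + y / (1 - n y / 6)\<close>, where \<open>y\<close> is \<open>c ^ 4\<close> divided by
  twice the sum of \<open>\<sigma> ^ 4\<close> over the block (\<open>minimax_rate_ge_of_blocks\<close>).

  Two choices of blocks and amplitudes are enough. Blocks of size at most three give every \<open>\<rho>\<close> with
  \<open>\<rho> ^ 4\<close> at most the sum of all \<open>\<sigma> ^ 4\<close> (\<open>rate_ge_of_short_blocks\<close>): merging positions costs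
  nothing, because for such sizes the factor is about \<open>exp y\<close>. On the \<open>k\<close> noisiest coordinates this is
  the bound \<open>r2\<close>, and it also gives the terms of \<open>r1\<close> with \<open>n = D - l \<le> 3 m\<close>. For larger
  \<open>n\<close>, the least noisy of the \<open>n\<close> coordinates is discarded and the amplitudes follow the smallest
  variance of each block (\<open>rate_ge_of_long_blocks\<close>). Apart from one small case, the logarithm in \<open>r1\<close> enters only through
  \<open>(ln (1 + u))\<^sup>2 \<le> u\<^sup>2 / (1 + u)\<close> with \<open>u\<^sup>2 = n / D\<close>; its gain over \<open>u\<^sup>2\<close> pays for the difference
  between \<open>k\<^sup>2\<close> and \<open>D\<close>.
\<close>

section \<open>Likelihood ratios of shifted white noise\<close>

abbreviation std_gauss :: "real measure" where
  "std_gauss \<equiv> density lborel std_normal_density"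

abbreviation gauss_seq :: "nat set \<Rightarrow> (nat \<Rightarrow> real) measure" where
  "gauss_seq J \<equiv> (\<Pi>\<^sub>M j\<in>J. std_gauss)"

lemma prob_space_std_gauss: "prob_space std_gauss"
  by (simp add: prob_space_normal_density)

interpretation std: prob_space std_gauss
  by (rule prob_space_std_gauss)

interpretation gauss: product_prob_space "\<lambda>_::nat. std_gauss" J for J
  by unfold_locales

text \<open>
  Completing the square: tilting the standard normal law by \<open>exp (\<mu> x - \<mu>\<^sup>2 / 2)\<close> moves its
  mean to \<open>\<mu>\<close>.
\<close>

lemma nn_integral_gauss_tilt:
  assumes [measurable]: "X \<in> sets borel"
  shows "(\<integral>\<^sup>+x. ennreal (exp (\<mu> * x - \<mu>\<^sup>2 / 2)) * indicator X x \<partial>std_gauss)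
           = emeasure std_gauss ((\<lambda>x. \<mu> + x) -` X)"
proof -
  have "(\<lambda>x. \<mu> + x) -` X \<inter> space borel \<in> sets borel"
    by (rule measurable_sets[OF _ assms]) auto
  then have [measurable]: "(\<lambda>x. \<mu> + x) -` X \<in> sets borel" by simp
  have *: "std_normal_density x * exp (\<mu> * x - \<mu>\<^sup>2 / 2) = std_normal_density (x - \<mu>)" for x
    by (simp add: std_normal_density_def flip: exp_add)
       (simp add: power2_eq_square field_simps)
  have "(\<integral>\<^sup>+x. ennreal (exp (\<mu> * x - \<mu>\<^sup>2 / 2)) * indicator X x \<partial>std_gauss)
      = (\<integral>\<^sup>+x. ennreal (std_normal_density x) * (ennreal (exp (\<mu> * x - \<mu>\<^sup>2 / 2)) * indicator X x) \<partial>lborel)"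
    by (subst nn_integral_density) auto
  also have "\<dots> = (\<integral>\<^sup>+x. ennreal (std_normal_density (x - \<mu>)) * indicator X x \<partial>lborel)"
    by (intro nn_integral_cong) (simp add: * mult.assoc[symmetric] flip: ennreal_mult)
  also have "\<dots> = (\<integral>\<^sup>+x. ennreal (std_normal_density x) * indicator X (\<mu> + x) \<partial>lborel)"
    by (subst nn_integral_real_affine[where c=1 and t=\<mu>]) auto
  also have "\<dots> = (\<integral>\<^sup>+x. ennreal (std_normal_density x) * indicator ((\<lambda>x. \<mu> + x) -` X) x \<partial>lborel)"
    by (intro nn_integral_cong) (auto simp: indicator_def)
  also have "\<dots> = emeasure std_gauss ((\<lambda>x. \<mu> + x) -` X)"
    by (subst emeasure_density) auto
  finally show ?thesis .
qed

lemma nn_integral_gauss_seq_prod: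
  assumes "finite K" "K \<subseteq> J" and f[measurable]: "\<And>j. j \<in> K \<Longrightarrow> f j \<in> borel_measurable borel"
  shows "(\<integral>\<^sup>+x. (\<Prod>j\<in>K. f j (x j)) \<partial>gauss_seq J) = (\<Prod>j\<in>K. \<integral>\<^sup>+x. f j x \<partial>std_gauss)"
proof -
  have f': "\<And>j. j \<in> K \<Longrightarrow> f j \<in> borel_measurable std_gauss" using f by simp
  have "(\<Prod>j\<in>K. \<integral>\<^sup>+x. f j x \<partial>std_gauss) = (\<integral>\<^sup>+x. (\<Prod>j\<in>K. f j (x j)) \<partial>gauss_seq K)"
    using assms(1) f' by (intro gauss.product_nn_integral_prod[symmetric]) auto
  also have "\<dots> = (\<integral>\<^sup>+x. (\<Prod>j\<in>K. f j (x j)) \<partial>distr (gauss_seq J) (gauss_seq K) (\<lambda>x. restrict x K))"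
    by (subst gauss.distr_PiM_restrict_finite[OF assms(1,2)]) simp
  also have "\<dots> = (\<integral>\<^sup>+x. (\<Prod>j\<in>K. f j (restrict x K j)) \<partial>gauss_seq J)"
  proof (rule nn_integral_distr)
    show "(\<lambda>x. restrict x K) \<in> gauss_seq J \<rightarrow>\<^sub>M gauss_seq K"
      using assms(2) by (rule measurable_restrict_subset)
    have "(\<lambda>x. \<Prod>j\<in>K. f j (x j)) \<in> borel_measurable (gauss_seq K)"
    proof (rule borel_measurable_prod_ennreal)
      fix j assume j: "j \<in> K"
      have "(\<lambda>x. x j) \<in> gauss_seq K \<rightarrow>\<^sub>M std_gauss"
        using j by (rule measurable_component_singleton)
      then show "(\<lambda>x. f j (x j)) \<in> borel_measurable (gauss_seq K)"
        using f'[OF j] by (rule measurable_compose)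
    qed
    then show "(\<lambda>x. \<Prod>j\<in>K. f j (x j))
        \<in> borel_measurable (distr (gauss_seq J) (gauss_seq K) (\<lambda>x. restrict x K))"
      by simp
  qed
  also have "\<dots> = (\<integral>\<^sup>+x. (\<Prod>j\<in>K. f j (x j)) \<partial>gauss_seq J)"
    by (intro nn_integral_cong prod.cong) auto
  finally show ?thesis ..
qed

definition shift_seq :: "nat set \<Rightarrow> (nat \<Rightarrow> real) \<Rightarrow> (nat \<Rightarrow> real) \<Rightarrow> (nat \<Rightarrow> real)" where
  "shift_seq J \<mu> \<epsilon> = (\<lambda>j\<in>J. \<mu> j + \<epsilon> j)"

text \<open>
  The likelihood ratio of white noise translated by \<open>\<mu>\<close> against white noise, for a \<open>\<mu>\<close>
  that vanishes outside \<open>K\<close>.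
\<close>

definition lik_ratio :: "nat set \<Rightarrow> (nat \<Rightarrow> real) \<Rightarrow> (nat \<Rightarrow> real) \<Rightarrow> real" where
  "lik_ratio K \<mu> \<epsilon> = exp (\<Sum>j\<in>K. \<mu> j * \<epsilon> j - (\<mu> j)\<^sup>2 / 2)"

lemma shift_seq_measurable [measurable]: "shift_seq J \<mu> \<in> gauss_seq J \<rightarrow>\<^sub>M gauss_seq J"
  unfolding shift_seq_def[abs_def] by (rule measurable_restrict) (auto)

lemma lik_ratio_measurable [measurable]:
  "K \<subseteq> J \<Longrightarrow> lik_ratio K \<mu> \<in> borel_measurable (gauss_seq J)"
  unfolding lik_ratio_def[abs_def]
  by (intro measurable_compose[OF _ borel_measurable_exp] borel_measurable_sum
    borel_measurable_diff borel_measurable_times) (auto simp: subset_eq)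

text \<open>
  The Cameron-Martin formula for finitely supported shifts. Both sides are compared on cylinders.
  The base of a cylinder is padded with the whole line so that it also covers the support \<open>K\<close>;
  then the density and the indicator are products over the same finite set of coordinates, and
  the one-dimensional tilting identity applies to each factor.
\<close>

lemma distr_shift_seq:
  assumes K: "finite K" "K \<subseteq> J" and 0: "\<And>j. j \<in> J - K \<Longrightarrow> \<mu> j = 0"
  shows "distr (gauss_seq J) (gauss_seq J) (shift_seq J \<mu>)
           = density (gauss_seq J) (\<lambda>\<epsilon>. ennreal (lik_ratio K \<mu> \<epsilon>))" (is "?P = ?Q")
proof (rule measure_eqI_PiM_infinite)
  show "sets ?P = sets (gauss_seq J)" "sets ?Q = sets (gauss_seq J)" by simp_all
  show "finite_measure ?P"
    by (intro prob_space.finite_measure prob_space.prob_space_distr gauss.P.prob_space_axioms) measurable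
  fix X F assume F: "finite F" "F \<subseteq> J" and X: "\<And>i. i \<in> F \<Longrightarrow> X i \<in> sets std_gauss"
  let ?E = "prod_emb J (\<lambda>_. std_gauss) F (Pi\<^sub>E F X)"
  have E: "?E \<in> sets (gauss_seq J)"
    using F X by (intro sets_PiM_I) auto
  have Xb [measurable]: "\<And>i. i \<in> F \<Longrightarrow> X i \<in> sets borel" using X by simp
  let ?Y = "\<lambda>i. (\<lambda>x. \<mu> i + x) -` X i"
  have Y: "\<And>i. i \<in> F \<Longrightarrow> ?Y i \<in> sets std_gauss"
  proof -
    fix i assume "i \<in> F"
    then have "(\<lambda>x. \<mu> i + x) -` X i \<inter> space borel \<in> sets borel"
      by (intro measurable_sets[OF _ Xb]) auto
    then show "?Y i \<in> sets std_gauss" by simp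
  qed
  have "emeasure ?P ?E = emeasure (gauss_seq J) (shift_seq J \<mu> -` ?E \<inter> space (gauss_seq J))"
    by (intro emeasure_distr E) measurable
  also have "shift_seq J \<mu> -` ?E \<inter> space (gauss_seq J) = prod_emb J (\<lambda>_. std_gauss) F (Pi\<^sub>E F ?Y)"
    using F(2) by (auto simp: prod_emb_def shift_seq_def space_PiM PiE_iff subset_eq)
  also have "emeasure (gauss_seq J) \<dots> = (\<Prod>i\<in>F. emeasure std_gauss (?Y i))"
    using F Y by (intro gauss.emeasure_PiM_emb) auto
  finally have 1: "emeasure ?P ?E = (\<Prod>i\<in>F. emeasure std_gauss (?Y i))" .
  define X' where "X' i = (if i \<in> F then X i else UNIV)" for i
  have X'[measurable]: "X' i \<in> sets borel" for i unfolding X'_def using Xb by auto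
  define h where "h j = (\<lambda>x. ennreal (exp (\<mu> j * x - (\<mu> j)\<^sup>2 / 2)) * indicator (X' j) x)" for j
  have h[measurable]: "h j \<in> borel_measurable borel" for j unfolding h_def by measurable
  have "emeasure ?Q ?E = (\<integral>\<^sup>+\<epsilon>. ennreal (lik_ratio K \<mu> \<epsilon>) * indicator ?E \<epsilon> \<partial>gauss_seq J)"
    using K E by (intro emeasure_density) auto
  also have "\<dots> = (\<integral>\<^sup>+\<epsilon>. (\<Prod>j\<in>K \<union> F. h j (\<epsilon> j)) \<partial>gauss_seq J)"
  proof (rule nn_integral_cong)
    fix \<epsilon> assume "\<epsilon> \<in> space (gauss_seq J)"
    then have \<epsilon>: "\<epsilon> \<in> extensional J" by (auto simp: space_PiM PiE_iff)
    have "(\<Sum>j\<in>K. \<mu> j * \<epsilon> j - (\<mu> j)\<^sup>2 / 2) = (\<Sum>j\<in>K \<union> F. \<mu> j * \<epsilon> j - (\<mu> j)\<^sup>2 / 2)"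
      using K F 0 by (intro sum.mono_neutral_left) auto
    then have "ennreal (lik_ratio K \<mu> \<epsilon>) = (\<Prod>j\<in>K \<union> F. ennreal (exp (\<mu> j * \<epsilon> j - (\<mu> j)\<^sup>2 / 2)))"
      using K F by (simp add: lik_ratio_def exp_sum prod_ennreal)
    moreover have "indicator ?E \<epsilon> = (\<Prod>j\<in>K \<union> F. indicator (X' j) (\<epsilon> j) :: ennreal)"
    proof (cases "\<epsilon> \<in> ?E")
      case True
      then show ?thesis by (auto simp: prod_emb_def X'_def PiE_iff intro!: prod.neutral[symmetric])
    next
      case False
      then obtain i where "i \<in> F" "\<epsilon> i \<notin> X i"
        using \<epsilon> F by (auto simp: prod_emb_def PiE_iff)
      then have "(\<Prod>j\<in>K \<union> F. indicator (X' j) (\<epsilon> j) :: ennreal) = 0"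
        using K F by (intro prod_zero) (auto intro!: bexI[of _ i] simp: X'_def)
      with False show ?thesis by simp
    qed
    ultimately show "ennreal (lik_ratio K \<mu> \<epsilon>) * indicator ?E \<epsilon> = (\<Prod>j\<in>K \<union> F. h j (\<epsilon> j))"
      by (simp add: h_def prod.distrib)
  qed
  also have "\<dots> = (\<Prod>j\<in>K \<union> F. \<integral>\<^sup>+x. h j x \<partial>std_gauss)"
    using K F by (intro nn_integral_gauss_seq_prod) auto
  also have "\<dots> = (\<Prod>j\<in>K \<union> F. emeasure std_gauss ((\<lambda>x. \<mu> j + x) -` X' j))"
    unfolding h_def by (intro prod.cong nn_integral_gauss_tilt) auto
  also have "\<dots> = (\<Prod>j\<in>F. emeasure std_gauss (?Y j))"
    using K F by (intro prod.mono_neutral_cong_right)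
      (auto simp: X'_def prob_space.emeasure_space_1[OF prob_space_std_gauss, simplified])
  finally show "emeasure ?P ?E = emeasure ?Q ?E" using 1 by simp
qed

lemma integral_lik_ratio:
  assumes "finite K" "K \<subseteq> J"
  shows "integrable (gauss_seq J) (lik_ratio K \<mu>)" "(\<integral>\<epsilon>. lik_ratio K \<mu> \<epsilon> \<partial>gauss_seq J) = 1"
proof -
  let ?\<mu> = "\<lambda>j. if j \<in> K then \<mu> j else 0"
  have eq: "lik_ratio K ?\<mu> = lik_ratio K \<mu>" by (auto simp: lik_ratio_def fun_eq_iff intro!: sum.cong)
  have "prob_space (density (gauss_seq J) (\<lambda>\<epsilon>. ennreal (lik_ratio K \<mu> \<epsilon>)))"
    using distr_shift_seq[OF assms, of ?\<mu>]
    by (auto simp: eq intro!: prob_space.prob_space_distr gauss.P.prob_space_axioms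
      dest!: sym[of "distr _ _ _"])
  from prob_space.emeasure_space_1[OF this]
  have 1: "(\<integral>\<^sup>+\<epsilon>. ennreal (lik_ratio K \<mu> \<epsilon>) \<partial>gauss_seq J) = 1"
    using assms by (simp add: emeasure_density cong: nn_integral_cong)
  have "has_bochner_integral (gauss_seq J) (lik_ratio K \<mu>) 1"
    using assms 1 by (intro has_bochner_integral_nn_integral) (auto simp: lik_ratio_def)
  then show "integrable (gauss_seq J) (lik_ratio K \<mu>)" "(\<integral>\<epsilon>. lik_ratio K \<mu> \<epsilon> \<partial>gauss_seq J) = 1"
    by (auto simp: has_bochner_integral_iff)
qed

text \<open>
  A product of two likelihood ratios is again one, up to a constant. Hence the second moment of a
  mixture of likelihood ratios needs no further integration.
\<close>

lemma lik_ratio_mult: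
  "lik_ratio K \<mu> \<epsilon> * lik_ratio K \<nu> \<epsilon> = exp (\<Sum>j\<in>K. \<mu> j * \<nu> j) * lik_ratio K (\<lambda>j. \<mu> j + \<nu> j) \<epsilon>"
  by (simp add: lik_ratio_def flip: exp_add sum.distrib)
     (rule sum.cong, simp_all add: power2_eq_square field_simps)

lemma measure_shift_seq:
  assumes K: "finite K" "K \<subseteq> J" and 0: "\<And>j. j \<in> J - K \<Longrightarrow> \<mu> j = 0" and A: "A \<in> sets (gauss_seq J)"
  shows "measure (gauss_seq J) (shift_seq J \<mu> -` A \<inter> space (gauss_seq J))
    = (\<integral>\<epsilon>. lik_ratio K \<mu> \<epsilon> * indicator A \<epsilon> \<partial>gauss_seq J)"
proof -
  have meas: "lik_ratio K \<mu> \<in> borel_measurable (gauss_seq J)"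
    using K(2) by (rule lik_ratio_measurable)
  have "measure (gauss_seq J) (shift_seq J \<mu> -` A \<inter> space (gauss_seq J))
     = measure (density (gauss_seq J) (\<lambda>\<epsilon>. ennreal (lik_ratio K \<mu> \<epsilon>))) A"
    using measure_distr[OF shift_seq_measurable A, of \<mu>] distr_shift_seq[OF K 0] by simp
  also have "\<dots> = (\<integral>\<epsilon>. lik_ratio K \<mu> \<epsilon> * indicator A \<epsilon> \<partial>gauss_seq J)"
  proof -
    have nn: "0 \<le> lik_ratio K \<mu> \<epsilon>" for \<epsilon> by (simp add: lik_ratio_def)
    have "(\<integral>\<epsilon>. lik_ratio K \<mu> \<epsilon> * indicator A \<epsilon> \<partial>gauss_seq J)
        = enn2real (\<integral>\<^sup>+\<epsilon>. ennreal (lik_ratio K \<mu> \<epsilon> * indicator A \<epsilon>) \<partial>gauss_seq J)"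
      using A meas nn by (intro integral_eq_nn_integral) auto
    also have "\<dots> = enn2real (\<integral>\<^sup>+\<epsilon>. ennreal (lik_ratio K \<mu> \<epsilon>) * indicator A \<epsilon> \<partial>gauss_seq J)"
      by (intro arg_cong[of _ _ enn2real] nn_integral_cong) (auto simp: indicator_def)
    also have "\<dots> = measure (density (gauss_seq J) (\<lambda>\<epsilon>. ennreal (lik_ratio K \<mu> \<epsilon>))) A"
      unfolding measure_def using A meas by (subst emeasure_density) auto
    finally show ?thesis ..
  qed
  finally show ?thesis .
qed

text \<open>
  The second moment method. Let \<open>L\<close> be the likelihood ratio of the mixture. Since \<open>L - 1\<close> has
  mean \<open>0\<close>, the mixture probability of \<open>A\<close> minus its null probability is at most
  half the mean of \<open>\<bar>L - 1\<bar>\<close>, and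
  \<open>\<bar>L - 1\<bar> \<le> ((L - 1)\<^sup>2 + c\<^sup>2) / (2 c)\<close> reduces this to the second moment.
\<close>

lemma mixture_power_bound:
  fixes w :: "'t \<Rightarrow> real" and \<mu> :: "'t \<Rightarrow> nat \<Rightarrow> real"
  assumes K: "finite K" "K \<subseteq> J" and 0: "\<And>t j. t \<in> T \<Longrightarrow> j \<in> J - K \<Longrightarrow> \<mu> t j = 0"
    and A: "A \<in> sets (gauss_seq J)"
    and T: "finite T" and w: "(\<Sum>t\<in>T. w t) = 1" and c: "0 < c"
    and chi: "(\<Sum>s\<in>T. \<Sum>t\<in>T. w s * w t * exp (\<Sum>j\<in>K. \<mu> s j * \<mu> t j)) \<le> 1 + c\<^sup>2"
  shows "(\<Sum>t\<in>T. w t * measure (gauss_seq J) (shift_seq J (\<mu> t) -` A \<inter> space (gauss_seq J)))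
    \<le> measure (gauss_seq J) A + c / 2"
proof -
  let ?N = "gauss_seq J"
  define L where "L \<epsilon> = (\<Sum>t\<in>T. w t * lik_ratio K (\<mu> t) \<epsilon>)" for \<epsilon>
  have intL: "integrable ?N L" unfolding L_def
    by (intro Bochner_Integration.integrable_sum integrable_mult_right integral_lik_ratio K)
  have EL: "(\<integral>\<epsilon>. L \<epsilon> \<partial>?N) = 1"
    unfolding L_def using w
    by (subst Bochner_Integration.integral_sum)
       (auto intro!: integrable_mult_right integral_lik_ratio K simp: integral_lik_ratio[OF K])
  have L2: "(L \<epsilon>)\<^sup>2 = (\<Sum>s\<in>T. \<Sum>t\<in>T. w s * w t * exp (\<Sum>j\<in>K. \<mu> s j * \<mu> t j)
      * lik_ratio K (\<lambda>j. \<mu> s j + \<mu> t j) \<epsilon>)" for \<epsilon>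
    unfolding L_def power2_eq_square sum_product
    by (intro sum.cong refl) (use lik_ratio_mult in \<open>simp add: mult_ac\<close>)
  have intL2: "integrable ?N (\<lambda>\<epsilon>. (L \<epsilon>)\<^sup>2)" unfolding L2
    by (intro Bochner_Integration.integrable_sum integrable_mult_right integral_lik_ratio K)
  have "(\<integral>\<epsilon>. (L \<epsilon>)\<^sup>2 \<partial>?N) = (\<Sum>s\<in>T. \<Sum>t\<in>T. w s * w t * exp (\<Sum>j\<in>K. \<mu> s j * \<mu> t j))"
    unfolding L2
    by (subst Bochner_Integration.integral_sum, auto intro!: Bochner_Integration.integrable_sum
         integrable_mult_right integral_lik_ratio K)
       (subst Bochner_Integration.integral_sum, auto intro!: Bochner_Integration.integrable_sum
         integrable_mult_right integral_lik_ratio K simp: integral_lik_ratio[OF K])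
  then have EL2: "(\<integral>\<epsilon>. (L \<epsilon>)\<^sup>2 \<partial>?N) \<le> 1 + c\<^sup>2" using chi by simp
  have intA: "integrable ?N (\<lambda>\<epsilon>. L \<epsilon> * indicator A \<epsilon>)"
    using intL A by (intro integrable_real_mult_indicator)
  have "(\<Sum>t\<in>T. w t * measure ?N (shift_seq J (\<mu> t) -` A \<inter> space ?N))
     = (\<Sum>t\<in>T. w t * (\<integral>\<epsilon>. lik_ratio K (\<mu> t) \<epsilon> * indicator A \<epsilon> \<partial>?N))"
    using K 0 A by (intro sum.cong refl arg_cong2[of _ _ _ _ "(*)"] measure_shift_seq) auto
  also have "\<dots> = (\<integral>\<epsilon>. L \<epsilon> * indicator A \<epsilon> \<partial>?N)"
    unfolding L_def sum_distrib_right mult.assoc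
    by (subst Bochner_Integration.integral_sum)
       (auto intro!: integrable_mult_right integrable_real_mult_indicator integral_lik_ratio K A)
  finally have 1: "(\<Sum>t\<in>T. w t * measure ?N (shift_seq J (\<mu> t) -` A \<inter> space ?N))
     = (\<integral>\<epsilon>. L \<epsilon> * indicator A \<epsilon> \<partial>?N)" .
  have pw: "L \<epsilon> * indicator A \<epsilon> \<le> indicator A \<epsilon> + (L \<epsilon> - 1) / 2 + ((L \<epsilon>)\<^sup>2 - 2 * L \<epsilon> + 1) / (4 * c) + c / 4" for \<epsilon>
  proof -
    have sq: "2 * c * \<bar>x\<bar> \<le> x\<^sup>2 + c\<^sup>2" for x
      using sum_squares_bound[of "\<bar>x\<bar>" c] by (simp add: mult_ac)
    have "\<bar>L \<epsilon> - 1\<bar> \<le> ((L \<epsilon> - 1)\<^sup>2 + c\<^sup>2) / (2 * c)"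
      using sq[of "L \<epsilon> - 1"] c by (simp add: field_simps)
    then have "\<bar>L \<epsilon> - 1\<bar> / 2 \<le> ((L \<epsilon>)\<^sup>2 - 2 * L \<epsilon> + 1) / (4 * c) + c / 4"
      using c by (simp add: field_simps power2_eq_square)
    then obtain Z where Z: "Z = ((L \<epsilon>)\<^sup>2 - 2 * L \<epsilon> + 1) / (4 * c)" "\<bar>L \<epsilon> - 1\<bar> / 2 \<le> Z + c / 4"
      by blast
    have "\<bar>L \<epsilon> - 1\<bar> \<le> 2 * Z + c / 2" using Z(2) by simp
    then have "L \<epsilon> - 1 \<le> 2 * Z + c / 2" "- (L \<epsilon> - 1) \<le> 2 * Z + c / 2"
      by (simp_all only: abs_le_iff)
    then show ?thesis
      unfolding Z(1)[symmetric] by (cases "\<epsilon> \<in> A") (simp_all add: field_simps)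
  qed
  have "(\<integral>\<epsilon>. L \<epsilon> * indicator A \<epsilon> \<partial>?N)
     \<le> (\<integral>\<epsilon>. indicator A \<epsilon> + (L \<epsilon> - 1) / 2 + ((L \<epsilon>)\<^sup>2 - 2 * L \<epsilon> + 1) / (4 * c) + c / 4 \<partial>?N)"
    using intL intL2 intA A
    by (intro integral_mono pw) (auto intro!: integrable_real_indicator simp: gauss.P.emeasure_eq_measure)
  also have "\<dots> = measure ?N A + ((\<integral>\<epsilon>. (L \<epsilon>)\<^sup>2 \<partial>?N) - 1) / (4 * c) + c / 4"
    using intL intL2 A EL
    by (simp add: gauss.P.emeasure_eq_measure gauss.P.prob_space)
  also have "\<dots> \<le> measure ?N A + c\<^sup>2 / (4 * c) + c / 4"
    using EL2 c by (simp add: divide_right_mono)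
  also have "\<dots> = measure ?N A + c / 2" using c by (simp add: power2_eq_square)
  finally show ?thesis unfolding 1 .
qed

section \<open>Lower bounds from priors\<close>

text \<open>
  In the standardised observations \<open>y j / \<sigma> j\<close> the parameter \<open>\<theta>\<close> acts as the translation by
  \<open>\<theta> j / \<sigma> j\<close> of white noise, and \<open>A\<close> is the set of noise sequences that lead to rejection under
  the null hypothesis.
\<close>

lemma rejection_prob_eq_shift:
  assumes \<Phi>: "\<Phi> \<in> tests J" and \<sigma>: "\<And>j. j \<in> J \<Longrightarrow> \<sigma> j > 0"
  defines "A \<equiv> {\<epsilon> \<in> space (gauss_seq J). \<Phi> (\<lambda>j\<in>J. \<sigma> j * \<epsilon> j) = 1}"
  shows "A \<in> sets (gauss_seq J)"
    and "rejection_prob J \<sigma> \<Phi> \<theta>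
       = measure (gauss_seq J) (shift_seq J (\<lambda>j. \<theta> j / \<sigma> j) -` A \<inter> space (gauss_seq J))"
    and "rejection_prob J \<sigma> \<Phi> (\<lambda>j\<in>J. 0) = measure (gauss_seq J) A"
proof -
  let ?S = "{y \<in> space (\<Pi>\<^sub>M j\<in>J. borel). \<Phi> y = 1}"
  have S: "?S \<in> sets (\<Pi>\<^sub>M j\<in>J. borel)"
  proof -
    have "\<Phi> -` {1} \<inter> space (\<Pi>\<^sub>M j\<in>J. borel) \<in> sets (\<Pi>\<^sub>M j\<in>J. borel)"
      using \<Phi> unfolding tests_def by (rule measurable_sets) auto
    then show ?thesis by (simp add: vimage_def Int_def conj_commute)
  qed
  have M: "(\<lambda>\<epsilon>. \<lambda>j\<in>J. \<theta> j + \<sigma> j * \<epsilon> j) \<in> gauss_seq J \<rightarrow>\<^sub>M (\<Pi>\<^sub>M j\<in>J. borel)" for \<theta>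
    by (rule measurable_restrict) auto
  have R: "rejection_prob J \<sigma> \<Phi> \<theta>
     = measure (gauss_seq J) {\<epsilon> \<in> space (gauss_seq J). \<Phi> (\<lambda>j\<in>J. \<theta> j + \<sigma> j * \<epsilon> j) = 1}" for \<theta>
  proof -
    have "rejection_prob J \<sigma> \<Phi> \<theta> = measure (gauss_seq J)
        ((\<lambda>\<epsilon>. \<lambda>j\<in>J. \<theta> j + \<sigma> j * \<epsilon> j) -` ?S \<inter> space (gauss_seq J))"
      using measure_distr[OF M S] by (simp add: rejection_prob_def observation_law_def)
    also have "(\<lambda>\<epsilon>. \<lambda>j\<in>J. \<theta> j + \<sigma> j * \<epsilon> j) -` ?S \<inter> space (gauss_seq J)
        = {\<epsilon> \<in> space (gauss_seq J). \<Phi> (\<lambda>j\<in>J. \<theta> j + \<sigma> j * \<epsilon> j) = 1}"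
      by (auto simp: space_PiM)
    finally show ?thesis .
  qed
  have restr0: "(\<lambda>j\<in>J. (\<lambda>j\<in>J. 0) j + \<sigma> j * \<epsilon> j) = (\<lambda>j\<in>J. \<sigma> j * \<epsilon> j)" for \<epsilon>
    by (auto simp: restrict_def)
  show "rejection_prob J \<sigma> \<Phi> (\<lambda>j\<in>J. 0) = measure (gauss_seq J) A"
    unfolding R A_def restr0 ..
  have "(\<lambda>\<epsilon>. \<lambda>j\<in>J. 0 + \<sigma> j * \<epsilon> j) -` ?S \<inter> space (gauss_seq J) \<in> sets (gauss_seq J)"
    by (rule measurable_sets[OF M S])
  also have "(\<lambda>\<epsilon>. \<lambda>j\<in>J. 0 + \<sigma> j * \<epsilon> j) -` ?S \<inter> space (gauss_seq J) = A"
    by (auto simp: A_def space_PiM)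
  finally show "A \<in> sets (gauss_seq J)" .
  have "(\<lambda>j\<in>J. \<sigma> j * shift_seq J (\<lambda>j. \<theta> j / \<sigma> j) \<epsilon> j) = (\<lambda>j\<in>J. \<theta> j + \<sigma> j * \<epsilon> j)" for \<epsilon>
  proof (rule restrict_ext)
    fix j assume "j \<in> J"
    with \<sigma>[of j] show "\<sigma> j * shift_seq J (\<lambda>j. \<theta> j / \<sigma> j) \<epsilon> j = \<theta> j + \<sigma> j * \<epsilon> j"
      by (simp add: shift_seq_def distrib_left)
  qed
  then have "shift_seq J (\<lambda>j. \<theta> j / \<sigma> j) -` A \<inter> space (gauss_seq J)
      = {\<epsilon> \<in> space (gauss_seq J). \<Phi> (\<lambda>j\<in>J. \<theta> j + \<sigma> j * \<epsilon> j) = 1}"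
    by (auto simp: A_def) (auto simp: space_PiM shift_seq_def)
  then show "rejection_prob J \<sigma> \<Phi> \<theta>
       = measure (gauss_seq J) (shift_seq J (\<lambda>j. \<theta> j / \<sigma> j) -` A \<inter> space (gauss_seq J))"
    unfolding R by simp
qed

text \<open>
  If a test had rate below \<open>\<rho>\<close>, its power would exceed \<open>1 - \<beta>\<close> at every point of the prior,
  hence also on average. That contradicts the second moment method, because the level of the
  test leaves room for an average power of at most \<open>\<alpha> + c / 2\<close>.
\<close>

lemma minimax_rate_ge_of_prior:
  fixes w :: "'t \<Rightarrow> real" and \<theta> :: "'t \<Rightarrow> nat \<Rightarrow> real"
  assumes \<sigma>: "\<And>j. j \<in> J \<Longrightarrow> \<sigma> j > 0"
    and K: "finite K" "K \<subseteq> J" and 0: "\<And>t j. t \<in> T \<Longrightarrow> j \<in> J - K \<Longrightarrow> \<theta> t j = 0"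
    and T: "finite T" and w: "\<And>t. t \<in> T \<Longrightarrow> 0 \<le> w t" "(\<Sum>t\<in>T. w t) = 1"
    and F: "\<And>t. t \<in> T \<Longrightarrow> \<theta> t \<in> F" and norm: "\<And>t. t \<in> T \<Longrightarrow> \<rho> \<le> l2_norm J (\<theta> t)"
    and c: "0 < c" and \<alpha>\<beta>: "\<alpha> + \<beta> + c / 2 \<le> 1"
    and chi: "(\<Sum>s\<in>T. \<Sum>t\<in>T. w s * w t * exp (\<Sum>j\<in>K. \<theta> s j * \<theta> t j / (\<sigma> j)\<^sup>2)) \<le> 1 + c\<^sup>2"
  shows "ereal \<rho> \<le> minimax_rate J \<sigma> F \<alpha> \<beta>"
  unfolding minimax_rate_def test_rate_def
proof (intro INF_greatest Inf_greatest)
  fix \<Phi> x assume \<Phi>: "\<Phi> \<in> level_tests J \<sigma> \<alpha>"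
    and "x \<in> {ereal \<rho> | \<rho>. \<rho> > 0 \<and>
       (INF \<theta>\<in>{\<theta> \<in> F. l2_norm J \<theta> \<ge> \<rho>}. ereal (rejection_prob J \<sigma> \<Phi> \<theta>)) > ereal (1 - \<beta>)}"
  then obtain r where x: "x = ereal r"
    and r: "ereal (1 - \<beta>) < (INF \<theta>\<in>{\<theta> \<in> F. l2_norm J \<theta> \<ge> r}. ereal (rejection_prob J \<sigma> \<Phi> \<theta>))"
    by auto
  show "ereal \<rho> \<le> x"
  proof (rule ccontr)
    assume "\<not> ereal \<rho> \<le> x"
    then have "r < \<rho>" by (simp add: x)
    \<comment> \<open>A margin above \<open>1 - \<beta>\<close> that does not depend on the prior point survives averaging.\<close>
    obtain \<delta> where \<delta>: "1 - \<beta> < \<delta>"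
      "ereal \<delta> < (INF \<theta>\<in>{\<theta> \<in> F. l2_norm J \<theta> \<ge> r}. ereal (rejection_prob J \<sigma> \<Phi> \<theta>))"
      using ereal_dense2[OF r] by auto
    have power: "\<delta> \<le> rejection_prob J \<sigma> \<Phi> (\<theta> t)" if t: "t \<in> T" for t
    proof -
      have "(INF \<theta>\<in>{\<theta> \<in> F. l2_norm J \<theta> \<ge> r}. ereal (rejection_prob J \<sigma> \<Phi> \<theta>))
          \<le> ereal (rejection_prob J \<sigma> \<Phi> (\<theta> t))"
        using F[OF t] norm[OF t] \<open>r < \<rho>\<close> by (intro INF_lower) auto
      from less_le_trans[OF \<delta>(2) this] show ?thesis by simp
    qed
    let ?A = "{\<epsilon> \<in> space (gauss_seq J). \<Phi> (\<lambda>j\<in>J. \<sigma> j * \<epsilon> j) = 1}"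
    have test: "\<Phi> \<in> tests J" using \<Phi> by (simp add: level_tests_def)
    note rej = rejection_prob_eq_shift[OF test \<sigma>]
    have "(\<Sum>t\<in>T. w t * measure (gauss_seq J)
        (shift_seq J (\<lambda>j. \<theta> t j / \<sigma> j) -` ?A \<inter> space (gauss_seq J))) \<le> measure (gauss_seq J) ?A + c / 2"
    proof (rule mixture_power_bound[OF K _ rej(1) T w(2) c])
      show "\<theta> t j / \<sigma> j = 0" if "t \<in> T" "j \<in> J - K" for t j using 0[OF that] by simp
      have eq: "\<theta> s j / \<sigma> j * (\<theta> t j / \<sigma> j) = \<theta> s j * \<theta> t j / (\<sigma> j)\<^sup>2" for s t j
        by (simp add: power2_eq_square)
      show "(\<Sum>s\<in>T. \<Sum>t\<in>T. w s * w t * exp (\<Sum>j\<in>K. \<theta> s j / \<sigma> j * (\<theta> t j / \<sigma> j))) \<le> 1 + c\<^sup>2"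
        using chi by (simp only: eq)
    qed
    then have "(\<Sum>t\<in>T. w t * rejection_prob J \<sigma> \<Phi> (\<theta> t)) \<le> rejection_prob J \<sigma> \<Phi> (\<lambda>j\<in>J. 0) + c / 2"
      using rej(2,3) by simp
    also have "\<dots> \<le> \<alpha> + c / 2" using \<Phi> by (simp add: level_tests_def)
    finally have "(\<Sum>t\<in>T. w t * rejection_prob J \<sigma> \<Phi> (\<theta> t)) \<le> \<alpha> + c / 2" .
    moreover have "(\<Sum>t\<in>T. w t * \<delta>) \<le> (\<Sum>t\<in>T. w t * rejection_prob J \<sigma> \<Phi> (\<theta> t))"
      using power w(1) by (intro sum_mono mult_left_mono) auto
    moreover have "(\<Sum>t\<in>T. w t * \<delta>) = \<delta>" using w(2) by (simp flip: sum_distrib_right)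
    ultimately show False using \<delta>(1) \<alpha>\<beta> by linarith
  qed
qed

lemma sum_sum_PiE_prod:
  fixes f :: "'i \<Rightarrow> 'b \<Rightarrow> 'b \<Rightarrow> real"
  assumes I: "finite I" and S: "\<And>i. i \<in> I \<Longrightarrow> finite (S i)"
  shows "(\<Sum>s\<in>PiE I S. \<Sum>t\<in>PiE I S. \<Prod>i\<in>I. f i (s i) (t i)) = (\<Prod>i\<in>I. \<Sum>x\<in>S i. \<Sum>y\<in>S i. f i x y)"
proof -
  have "(\<Prod>i\<in>I. \<Sum>x\<in>S i. \<Sum>y\<in>S i. f i x y) = (\<Sum>s\<in>PiE I S. \<Prod>i\<in>I. \<Sum>y\<in>S i. f i (s i) y)"
    by (rule prod_sum_PiE[OF I S])
  also have "\<dots> = (\<Sum>s\<in>PiE I S. \<Sum>t\<in>PiE I S. \<Prod>i\<in>I. f i (s i) (t i))"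
    by (intro sum.cong refl prod_sum_PiE[OF I S])
  finally show ?thesis ..
qed

text \<open>
  The second moment contributed by one block. Two independent draws of a signed position interact
  only if the positions agree; averaging over the signs then turns \<open>exp\<close> into \<open>cosh\<close>.
\<close>

lemma sum_signed_choice:
  fixes q z :: "'a \<Rightarrow> real"
  assumes B: "finite B" and q: "(\<Sum>j\<in>B. q j) = 1"
  shows "(\<Sum>x\<in>B \<times> {-1, 1 :: real}. \<Sum>y\<in>B \<times> {-1, 1}. (q (fst x) / 2) * (q (fst y) / 2) *
            (if fst x = fst y then exp (snd x * snd y * z (fst x)) else 1))
         = 1 + (\<Sum>j\<in>B. (q j)\<^sup>2 * (cosh (z j) - 1))"
proof -
  let ?S = "{-1, 1 :: real}"
  have "(\<Sum>x\<in>B \<times> ?S. \<Sum>y\<in>B \<times> ?S. (q (fst x) / 2) * (q (fst y) / 2) *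
            (if fst x = fst y then exp (snd x * snd y * z (fst x)) else 1))
     = (\<Sum>x\<in>B \<times> ?S. \<Sum>y\<in>B \<times> ?S. (q (fst x) / 2) * (q (fst y) / 2) +
          (if fst x = fst y then (q (fst x))\<^sup>2 / 4 * (exp (snd x * snd y * z (fst x)) - 1) else 0))"
    by (intro sum.cong refl) (simp add: power2_eq_square right_diff_distrib)
  also have "\<dots> = (\<Sum>x\<in>B \<times> ?S. q (fst x) / 2) * (\<Sum>y\<in>B \<times> ?S. q (fst y) / 2) +
     (\<Sum>x\<in>B \<times> ?S. \<Sum>y\<in>B \<times> ?S.
        if fst x = fst y then (q (fst x))\<^sup>2 / 4 * (exp (snd x * snd y * z (fst x)) - 1) else 0)"
    by (simp only: sum.distrib sum_product)
  also have "(\<Sum>x\<in>B \<times> ?S. q (fst x) / 2) = 1"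
  proof -
    have "(\<Sum>x\<in>B \<times> ?S. q (fst x) / 2) = (\<Sum>j\<in>B. \<Sum>e\<in>?S. q j / 2)"
      by (simp only: sum.cartesian_product' fst_conv)
    also have "\<dots> = (\<Sum>j\<in>B. q j)" by (intro sum.cong refl) simp
    finally show ?thesis using q by simp
  qed
  also have "(\<Sum>x\<in>B \<times> ?S. \<Sum>y\<in>B \<times> ?S.
        if fst x = fst y then (q (fst x))\<^sup>2 / 4 * (exp (snd x * snd y * z (fst x)) - 1) else 0)
     = (\<Sum>j\<in>B. (q j)\<^sup>2 * (cosh (z j) - 1))"
  proof -
    have "(\<Sum>x\<in>B \<times> ?S. \<Sum>y\<in>B \<times> ?S.
        if fst x = fst y then (q (fst x))\<^sup>2 / 4 * (exp (snd x * snd y * z (fst x)) - 1) else 0)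
      = (\<Sum>j\<in>B. \<Sum>e\<in>?S. \<Sum>j'\<in>B. \<Sum>e'\<in>?S.
           if j = j' then (q j)\<^sup>2 / 4 * (exp (e * e' * z j) - 1) else 0)"
      by (simp only: sum.cartesian_product' fst_conv snd_conv)
    also have "\<dots> = (\<Sum>j\<in>B. \<Sum>e\<in>?S. \<Sum>e'\<in>?S. \<Sum>j'\<in>B.
           if j = j' then (q j)\<^sup>2 / 4 * (exp (e * e' * z j) - 1) else 0)"
      by (intro sum.cong refl sum.swap)
    also have "\<dots> = (\<Sum>j\<in>B. \<Sum>e\<in>?S. \<Sum>e'\<in>?S. (q j)\<^sup>2 / 4 * (exp (e * e' * z j) - 1))"
      using B by (intro sum.cong refl) simp
    also have "\<dots> = (\<Sum>j\<in>B. (q j)\<^sup>2 * (cosh (z j) - 1))"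
      by (intro sum.cong refl) (simp add: cosh_def algebra_simps)
    finally show ?thesis .
  qed
  finally show ?thesis by simp
qed

section \<open>Priors with one random coordinate per block\<close>

lemma infsum_finite_support:
  fixes f :: "nat \<Rightarrow> real"
  assumes W: "finite W" "W \<subseteq> J" and 0: "\<And>j. j \<in> J - W \<Longrightarrow> f j = 0"
  shows "f summable_on J" "infsum f J = sum f W"
proof -
  have "(f has_sum sum f W) W" using W(1) by simp
  then have "(f has_sum sum f W) J"
    using W 0 by (subst has_sum_cong_neutral[of W J f f]) auto
  then show "f summable_on J" "infsum f J = sum f W"
    by (auto simp: summable_on_def infsumI)
qed

text \<open>
  The prior behind all bounds. The coordinates in \<open>W\<close> are split into blocks by \<open>b\<close>. In block \<open>i\<close>
  one position \<open>j\<close> is drawn with probability \<open>q j\<close> and receives the value \<open>c i\<close> with a random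
  sign, independently over the blocks. Every draw has the same \<open>l\<^sub>2\<close> norm and at most one nonzero
  coordinate per block, and the second moment is a product over the blocks.
\<close>

lemma minimax_rate_ge_of_block_prior:
  fixes b :: "nat \<Rightarrow> 'i" and q a :: "nat \<Rightarrow> real" and c :: "'i \<Rightarrow> real"
  assumes \<sigma>: "\<And>j. j \<in> J \<Longrightarrow> \<sigma> j > 0" and a: "\<And>j. j \<in> J \<Longrightarrow> a j > 0" and p: "0 < p"
    and W: "finite W" "W \<subseteq> J" and I: "finite I" and b: "b ` W \<subseteq> I"
    and q: "\<And>j. j \<in> W \<Longrightarrow> 0 \<le> q j" "\<And>i. i \<in> I \<Longrightarrow> (\<Sum>j | j \<in> W \<and> b j = i. q j) = 1"
    and c: "\<And>i. i \<in> I \<Longrightarrow> 0 \<le> c i" and \<rho>: "0 \<le> \<rho>" "\<rho>\<^sup>2 \<le> (\<Sum>i\<in>I. (c i)\<^sup>2)"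
    and A: "\<And>j. j \<in> W \<Longrightarrow> a j \<le> A" "A powr p * (\<Sum>i\<in>I. c i powr p) \<le> R powr p"
    and e: "0 < e" and \<alpha>\<beta>: "\<alpha> + \<beta> + e / 2 \<le> 1"
    and chi: "(\<Prod>i\<in>I. 1 + (\<Sum>j | j \<in> W \<and> b j = i. (q j)\<^sup>2 * (cosh ((c i)\<^sup>2 / (\<sigma> j)\<^sup>2) - 1))) \<le> 1 + e\<^sup>2"
  shows "ereal \<rho> \<le> minimax_rate J \<sigma> (lp_ellipsoid J a p R) \<alpha> \<beta>"
proof -
  define S where "S i = {j \<in> W. b j = i} \<times> {-1, 1 :: real}" for i
  have finB: "finite {j \<in> W. b j = i}" for i using W(1) by simp
  have finS: "finite (S i)" for i unfolding S_def using finB by simp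
  define T where "T = PiE I S"
  have finT: "finite T" unfolding T_def using I finS by (intro finite_PiE) auto
  define w where "w s = (\<Prod>i\<in>I. q (fst (s i)) / 2)" for s :: "'i \<Rightarrow> nat \<times> real"
  define \<theta> where "\<theta> s = (\<lambda>j\<in>J. if j \<in> W \<and> fst (s (b j)) = j then snd (s (b j)) * c (b j) else 0)"
    for s :: "'i \<Rightarrow> nat \<times> real"
  have TD: "fst (s i) \<in> W" "b (fst (s i)) = i" "snd (s i) = -1 \<or> snd (s i) = 1"
    if "s \<in> T" "i \<in> I" for s i
    using that by (auto simp: T_def PiE_iff S_def)
  have \<theta>0: "\<theta> s j = 0" if "j \<in> J - W" for s j using that by (simp add: \<theta>_def)
  have \<theta>W: "\<theta> s j = (if fst (s (b j)) = j then snd (s (b j)) * c (b j) else 0)" if "j \<in> W" for s j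
    using that W by (auto simp: \<theta>_def)
  \<comment> \<open>The parameter vanishes off the chosen positions, one per block, so sums over \<open>W\<close> become sums over blocks.\<close>
  have key: "(\<Sum>j\<in>W. g j (\<theta> s j)) = (\<Sum>i\<in>I. g (fst (s i)) (snd (s i) * c i))"
    if s: "s \<in> T" and g: "\<And>j. g j 0 = 0" for s and g :: "nat \<Rightarrow> real \<Rightarrow> real"
  proof -
    have "(\<Sum>j\<in>W. g j (\<theta> s j)) = (\<Sum>i\<in>I. \<Sum>j | j \<in> W \<and> b j = i. g j (\<theta> s j))"
      using sum.group[OF W(1) I b, of "\<lambda>j. g j (\<theta> s j)"] by simp
    also have "\<dots> = (\<Sum>i\<in>I. g (fst (s i)) (snd (s i) * c i))"
    proof (rule sum.cong[OF refl])
      fix i assume i: "i \<in> I"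
      have "(\<Sum>j | j \<in> W \<and> b j = i. g j (\<theta> s j))
          = (\<Sum>j | j \<in> W \<and> b j = i. if fst (s i) = j then g (fst (s i)) (snd (s i) * c i) else 0)"
        by (intro sum.cong refl) (auto simp: \<theta>W g)
      also have "\<dots> = g (fst (s i)) (snd (s i) * c i)"
        using TD(1,2)[OF s i] finB by (subst sum.delta') auto
      finally show "(\<Sum>j | j \<in> W \<and> b j = i. g j (\<theta> s j)) = g (fst (s i)) (snd (s i) * c i)" .
    qed
    finally show ?thesis .
  qed
  have sq: "(\<Sum>j\<in>W. (\<theta> s j)\<^sup>2) = (\<Sum>i\<in>I. (c i)\<^sup>2)" if s: "s \<in> T" for s
  proof -
    have "(\<Sum>j\<in>W. (\<theta> s j)\<^sup>2) = (\<Sum>i\<in>I. (snd (s i) * c i)\<^sup>2)"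
      using key[OF s, of "\<lambda>_ x. x\<^sup>2"] by simp
    also have "\<dots> = (\<Sum>i\<in>I. (c i)\<^sup>2)"
    proof (rule sum.cong[OF refl])
      fix i assume "i \<in> I"
      from TD(3)[OF s this] show "(snd (s i) * c i)\<^sup>2 = (c i)\<^sup>2" by auto
    qed
    finally show ?thesis .
  qed
  have mem: "\<theta> s \<in> lp_ellipsoid J a p R" if s: "s \<in> T" for s
  proof -
    have 1: "(\<lambda>j. (\<theta> s j)\<^sup>2) summable_on J"
      using \<theta>0 by (intro infsum_finite_support(1)[OF W]) auto
    have z: "a j powr p * \<bar>\<theta> s j\<bar> powr p = 0" if "j \<in> J - W" for j using \<theta>0[OF that] by simp
    note 2 = infsum_finite_support[OF W, of "\<lambda>j. a j powr p * \<bar>\<theta> s j\<bar> powr p", OF z]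
    have "(\<Sum>j\<in>W. a j powr p * \<bar>\<theta> s j\<bar> powr p) \<le> (\<Sum>j\<in>W. A powr p * \<bar>\<theta> s j\<bar> powr p)"
      using A(1) a W p by (intro sum_mono mult_right_mono powr_mono2) (auto simp: less_imp_le subset_eq)
    also have "\<dots> = A powr p * (\<Sum>i\<in>I. \<bar>snd (s i) * c i\<bar> powr p)"
      using key[OF s, of "\<lambda>_ x. \<bar>x\<bar> powr p"] by (simp flip: sum_distrib_left)
    also have "(\<Sum>i\<in>I. \<bar>snd (s i) * c i\<bar> powr p) = (\<Sum>i\<in>I. c i powr p)"
      using TD(3)[OF s] c by (intro sum.cong refl) (force simp: abs_mult)
    also note A(2)
    finally show ?thesis
      unfolding lp_ellipsoid_def l2_space_def using 1 2 by (auto simp: \<theta>_def)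
  qed
  have norm: "\<rho> \<le> l2_norm J (\<theta> s)" if s: "s \<in> T" for s
  proof -
    have "infsum (\<lambda>j. (\<theta> s j)\<^sup>2) J = (\<Sum>i\<in>I. (c i)\<^sup>2)"
      using \<theta>0 sq[OF s] by (subst infsum_finite_support(2)[OF W]) auto
    then show ?thesis
      unfolding l2_norm_def using \<rho> by (simp add: real_le_rsqrt)
  qed
  have inner: "exp (\<Sum>j\<in>W. \<theta> s j * \<theta> t j / (\<sigma> j)\<^sup>2) = (\<Prod>i\<in>I. if fst (s i) = fst (t i)
      then exp (snd (s i) * snd (t i) * ((c i)\<^sup>2 / (\<sigma> (fst (s i)))\<^sup>2)) else 1)" (is "_ = ?R")
    if s: "s \<in> T" and t: "t \<in> T" for s t
  proof -
    have "(\<Sum>j\<in>W. \<theta> s j * \<theta> t j / (\<sigma> j)\<^sup>2)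
        = (\<Sum>i\<in>I. snd (s i) * c i * \<theta> t (fst (s i)) / (\<sigma> (fst (s i)))\<^sup>2)"
      using key[OF s, of "\<lambda>j x. x * \<theta> t j / (\<sigma> j)\<^sup>2"] by simp
    also have "\<dots> = (\<Sum>i\<in>I. if fst (s i) = fst (t i)
      then snd (s i) * snd (t i) * ((c i)\<^sup>2 / (\<sigma> (fst (s i)))\<^sup>2) else 0)"
    proof (rule sum.cong[OF refl])
      fix i assume "i \<in> I"
      note TD[OF s this] TD(2)[OF t this]
      then show "snd (s i) * c i * \<theta> t (fst (s i)) / (\<sigma> (fst (s i)))\<^sup>2 = (if fst (s i) = fst (t i)
          then snd (s i) * snd (t i) * ((c i)\<^sup>2 / (\<sigma> (fst (s i)))\<^sup>2) else 0)"
        by (auto simp: \<theta>W power2_eq_square)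
    qed
    finally have "exp (\<Sum>j\<in>W. \<theta> s j * \<theta> t j / (\<sigma> j)\<^sup>2) = (\<Prod>i\<in>I. exp (if fst (s i) = fst (t i)
      then snd (s i) * snd (t i) * ((c i)\<^sup>2 / (\<sigma> (fst (s i)))\<^sup>2) else 0))"
      using I by (simp add: exp_sum)
    also have "\<dots> = ?R" by (intro prod.cong) auto
    finally show ?thesis .
  qed
  have "(\<Sum>s\<in>T. \<Sum>t\<in>T. w s * w t * exp (\<Sum>j\<in>W. \<theta> s j * \<theta> t j / (\<sigma> j)\<^sup>2))
      = (\<Sum>s\<in>T. \<Sum>t\<in>T. \<Prod>i\<in>I. (q (fst (s i)) / 2) * (q (fst (t i)) / 2) * (if fst (s i) = fst (t i)
          then exp (snd (s i) * snd (t i) * ((c i)\<^sup>2 / (\<sigma> (fst (s i)))\<^sup>2)) else 1))"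
    by (intro sum.cong refl, simp only: inner w_def prod.distrib)
  also have "\<dots> = (\<Prod>i\<in>I. \<Sum>x\<in>S i. \<Sum>y\<in>S i. (q (fst x) / 2) * (q (fst y) / 2) *
      (if fst x = fst y then exp (snd x * snd y * ((c i)\<^sup>2 / (\<sigma> (fst x))\<^sup>2)) else 1))"
    unfolding T_def by (rule sum_sum_PiE_prod[OF I finS])
  also have "\<dots> = (\<Prod>i\<in>I. 1 + (\<Sum>j | j \<in> W \<and> b j = i. (q j)\<^sup>2 * (cosh ((c i)\<^sup>2 / (\<sigma> j)\<^sup>2) - 1)))"
    unfolding S_def by (intro prod.cong refl sum_signed_choice finB q(2))
  also note chi
  finally have chi': "(\<Sum>s\<in>T. \<Sum>t\<in>T. w s * w t * exp (\<Sum>j\<in>W. \<theta> s j * \<theta> t j / (\<sigma> j)\<^sup>2)) \<le> 1 + e\<^sup>2" .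
  have "(\<Sum>s\<in>T. w s) = (\<Prod>i\<in>I. \<Sum>x\<in>S i. q (fst x) / 2)"
    unfolding T_def w_def by (rule prod_sum_PiE[OF I finS, symmetric])
  also have "\<dots> = 1"
  proof (rule prod.neutral, rule ballI)
    fix i assume "i \<in> I"
    have "(\<Sum>x\<in>S i. q (fst x) / 2) = (\<Sum>j | j \<in> W \<and> b j = i. \<Sum>e\<in>{-1, 1 :: real}. q j / 2)"
      by (simp only: S_def sum.cartesian_product' fst_conv)
    also have "\<dots> = (\<Sum>j | j \<in> W \<and> b j = i. q j)" by (intro sum.cong refl) simp
    finally show "(\<Sum>x\<in>S i. q (fst x) / 2) = 1" using q(2)[OF \<open>i \<in> I\<close>] by simp
  qed
  finally have w1: "(\<Sum>s\<in>T. w s) = 1" .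
  have w0: "0 \<le> w s" if "s \<in> T" for s
    unfolding w_def using TD(1)[OF that] q(1) by (intro prod_nonneg) auto
  show ?thesis
    by (rule minimax_rate_ge_of_prior[where T=T and w=w and \<theta>=\<theta> and K=W, OF \<sigma> W _ finT w0 w1 mem norm e \<alpha>\<beta> chi'])
       (use \<theta>0 in auto)
qed

lemma cosh_series: "(\<lambda>n. x ^ (2 * n) / fact (2 * n)) sums cosh (x :: real)"
proof -
  have "strict_mono (\<lambda>n::nat. 2 * n)" by (simp add: strict_mono_def)
  moreover have "n \<notin> range (\<lambda>n::nat. 2 * n) \<Longrightarrow> (if even n then x ^ n /\<^sub>R fact n else 0) = 0" for n
    by (auto simp: image_iff elim!: evenE)
  ultimately have "(\<lambda>n. (if even (2 * n) then x ^ (2 * n) /\<^sub>R fact (2 * n) else 0)) sums cosh x"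
    using cosh_converges[of x] by (subst sums_mono_reindex) auto
  then show ?thesis by (simp add: divide_inverse mult.commute)
qed

text \<open>
  Equivalently \<open>(12 - z\<^sup>2) (cosh z - 1) \<le> 6 z\<^sup>2\<close>. This holds coefficientwise in the power series,
  because \<open>(2 n + 4) (2 n + 3) \<ge> 12\<close>. The left-hand side is the beginning of the Laurent series of
  \<open>1 / (cosh z - 1)\<close>, so little is lost for the moderate values of \<open>z\<close> that matter; for large \<open>z\<close>
  the bound is negative.
\<close>

lemma inverse_cosh_minus_1_ge:
  fixes z :: real
  assumes "0 < z"
  shows "2 / z\<^sup>2 - 1 / 6 \<le> 1 / (cosh z - 1)"
proof -
  define u where "u n = z ^ (2 * n) / fact (2 * n)" for n :: nat
  have 1: "(\<lambda>n. u (n + 1)) sums (cosh z - 1)"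
    using sums_split_initial_segment[of u "cosh z" 1] cosh_series[of z]
    by (simp add: u_def[abs_def])
  have 2: "(\<lambda>n. u (n + 2)) sums (cosh z - 1 - z\<^sup>2 / 2)"
    using sums_split_initial_segment[of u "cosh z" 2] cosh_series[of z]
    by (simp add: u_def[abs_def] numeral_2_eq_2 algebra_simps)
  have le: "12 * u (n + 2) \<le> z\<^sup>2 * u (n + 1)" for n
  proof -
    have "fact (2 * (n + 2)) = (real (2 * n + 4) * real (2 * n + 3)) * (fact (2 * (n + 1)) :: real)"
      by (simp add: algebra_simps)
    moreover have "12 \<le> real (2 * n + 4) * real (2 * n + 3)"
      using mult_mono[of 4 "real (2 * n + 4)" 3 "real (2 * n + 3)"] by simp
    moreover have "z ^ (2 * (n + 2)) = z\<^sup>2 * z ^ (2 * (n + 1))"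
      by (simp add: power_add power2_eq_square algebra_simps)
    moreover have "12 * (z\<^sup>2 * X / (F * G)) \<le> z\<^sup>2 * (X / G)"
      if "12 \<le> F" "0 < G" "0 \<le> X" for F G X :: real
      using that mult_right_mono[of 12 F "z\<^sup>2 * X"] by (simp add: field_simps)
    moreover have "0 \<le> z ^ (2 * (n + 1))" by (rule zero_le_even_power) simp
    ultimately show ?thesis
      unfolding u_def by (metis fact_gt_zero)
  qed
  have "12 * (cosh z - 1 - z\<^sup>2 / 2) \<le> z\<^sup>2 * (cosh z - 1)"
    using sums_le[OF le sums_mult[OF 2] sums_mult[OF 1]] by simp
  moreover have "cosh z > 1" using assms using cosh_real_strict_mono[of 0 z] by simp
  ultimately show ?thesis
    using assms by (simp add: field_simps)
qed

section \<open>Optimal choice probabilities\<close>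

text \<open>
  The power mean inequality \<open>\<Sum>c i powr p \<le> m powr (1 - p / 2) * (\<Sum>(c i)\<^sup>2) powr (p / 2)\<close>
  for \<open>m = card I\<close>, proved by bounding the concave function \<open>\<lambda>s. s powr (p / 2)\<close> by its tangent
  at the mean of the squares. As \<open>1 - p / 2 > 0\<close>, the cardinality may be replaced by \<open>x\<close>.
\<close>

lemma sum_powr_le_of_sum_squares:
  fixes c :: "'i \<Rightarrow> real"
  assumes I: "finite I" "I \<noteq> {}" and c: "\<And>i. i \<in> I \<Longrightarrow> 0 < c i" and p: "0 < p" "p < 2"
    and A: "0 < A" and R: "0 < R" and x: "real (card I) \<le> x"
    and le: "(\<Sum>i\<in>I. (c i)\<^sup>2) \<le> x powr (1 - 2 / p) * R\<^sup>2 / A\<^sup>2"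
  shows "A powr p * (\<Sum>i\<in>I. c i powr p) \<le> R powr p"
proof -
  define m where "m = real (card I)"
  define s where "s = (\<Sum>i\<in>I. (c i)\<^sup>2)"
  have m: "0 < m" using I by (simp add: m_def card_gt_0_iff)
  have s: "0 < s" unfolding s_def using I c by (intro sum_pos zero_less_power)
  have pt: "c i powr p \<le> (s / m) powr (p / 2 - 1) * (p / 2 * (c i)\<^sup>2 + (1 - p / 2) * (s / m))"
    if i: "i \<in> I" for i
  proof -
    have "((c i)\<^sup>2) powr (p / 2) * (s / m) powr (1 - p / 2) \<le> p / 2 * (c i)\<^sup>2 + (1 - p / 2) * (s / m)"
      using p m s c[OF i] by (intro Youngs_inequality_0) auto
    then have "(s / m) powr (p / 2 - 1) * (((c i)\<^sup>2) powr (p / 2) * (s / m) powr (1 - p / 2))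
      \<le> (s / m) powr (p / 2 - 1) * (p / 2 * (c i)\<^sup>2 + (1 - p / 2) * (s / m))"
      by (rule mult_left_mono) simp
    moreover have "(s / m) powr (p / 2 - 1) * (((c i)\<^sup>2) powr (p / 2) * (s / m) powr (1 - p / 2))
        = ((c i)\<^sup>2) powr (p / 2)"
      using s m by (simp add: powr_add[symmetric] mult.left_commute)
    moreover have "((c i)\<^sup>2) powr (p / 2) = c i powr p"
      using c[OF i] by (simp add: powr_powr flip: powr_numeral)
    ultimately show ?thesis by (simp only:)
  qed
  have "(\<Sum>i\<in>I. c i powr p)
      \<le> (\<Sum>i\<in>I. (s / m) powr (p / 2 - 1) * (p / 2 * (c i)\<^sup>2 + (1 - p / 2) * (s / m)))"
    by (rule sum_mono) (rule pt)
  also have "\<dots> = (s / m) powr (p / 2 - 1) * (p / 2 * s + m * ((1 - p / 2) * (s / m)))"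
    by (simp only: sum_distrib_left[symmetric] sum.distrib s_def m_def sum_constant mult.left_commute)
  also have "p / 2 * s + m * ((1 - p / 2) * (s / m)) = s" using m by (simp add: field_simps)
  also have "(s / m) powr (p / 2 - 1) * s = m powr (1 - p / 2) * s powr (p / 2)"
  proof -
    have "s powr (p / 2) = s powr (p / 2 - 1) * s"
      using powr_add[of s "p / 2 - 1" 1] s by simp
    moreover have "m powr (1 - p / 2) = 1 / m powr (p / 2 - 1)"
      using powr_minus_divide[of m "p / 2 - 1"] by simp
    ultimately show ?thesis using s m by (simp add: powr_divide)
  qed
  also have "\<dots> \<le> x powr (1 - p / 2) * (x powr (1 - 2 / p) * R\<^sup>2 / A\<^sup>2) powr (p / 2)"
    using p m s x le by (intro mult_mono powr_mono2) (auto simp: m_def s_def)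
  also have "\<dots> = x powr (1 - p / 2 + (1 - 2 / p) * (p / 2)) * (R powr p / A powr p)"
    using p A R m x by (simp add: powr_mult powr_divide powr_powr powr_add m_def flip: powr_numeral)
  also have "\<dots> = R powr p / A powr p"
    using p m x by (simp add: field_simps m_def)
  finally show ?thesis using A by (simp add: field_simps)
qed

text \<open>
  Inside a block the best weights are inversely proportional to the excesses
  \<open>cosh (c\<^sup>2 / \<sigma>\<^sup>2) - 1\<close> of the single positions: with \<open>f j\<close> their reciprocals, the block
  contributes \<open>1 + 1 / (\<Sum>f j)\<close>. The quadratic lower bound on \<open>f j\<close> makes this a function of
  the size of the block and of \<open>\<Sum>\<sigma> j ^ 4\<close> alone. Positions with very small \<open>\<sigma> j\<close> cost nothing:
  their weight is negligible.
\<close>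

lemma minimax_rate_ge_of_blocks:
  fixes b :: "nat \<Rightarrow> 'i" and a :: "nat \<Rightarrow> real" and c :: "'i \<Rightarrow> real"
  assumes \<sigma>: "\<And>j. j \<in> J \<Longrightarrow> \<sigma> j > 0" and a: "\<And>j. j \<in> J \<Longrightarrow> a j > 0" and p: "0 < p" "p < 2"
    and R: "0 < R" and e: "0 < e" and \<alpha>\<beta>: "\<alpha> + \<beta> + e / 2 \<le> 1"
    and W: "finite W" "W \<subseteq> J" and A: "0 < A" "\<And>j. j \<in> W \<Longrightarrow> a j \<le> A"
    and I: "finite I" "I \<noteq> {}" and b: "b ` W = I" and c: "\<And>i. i \<in> I \<Longrightarrow> 0 < c i"
    and \<rho>: "0 \<le> \<rho>" "(\<Sum>i\<in>I. (c i)\<^sup>2) = \<rho>\<^sup>2"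
    and x: "real (card I) \<le> x" "\<rho>\<^sup>2 \<le> x powr (1 - 2 / p) * R\<^sup>2 / A\<^sup>2"
  defines "B \<equiv> \<lambda>i. {j \<in> W. b j = i}"
  defines "y \<equiv> \<lambda>i. (c i) ^ 4 / (2 * (\<Sum>j\<in>B i. (\<sigma> j) ^ 4))"
  assumes small: "\<And>i. i \<in> I \<Longrightarrow> real (card (B i)) * y i < 6"
    and chi: "(\<Prod>i\<in>I. 1 + y i / (1 - real (card (B i)) * y i / 6)) \<le> 1 + e\<^sup>2"
  shows "ereal \<rho> \<le> minimax_rate J \<sigma> (lp_ellipsoid J a p R) \<alpha> \<beta>"
proof -
  define f where "f j = 1 / (cosh ((c (b j))\<^sup>2 / (\<sigma> j)\<^sup>2) - 1)" for j
  define q where "q j = f j / (\<Sum>k\<in>B (b j). f k)" for j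
  have finB: "finite (B i)" for i using W by (simp add: B_def)
  have ne: "B i \<noteq> {}" if "i \<in> I" for i using that b by (auto simp: B_def)
  have zpos: "0 < (c (b j))\<^sup>2 / (\<sigma> j)\<^sup>2" if "j \<in> W" for j
  proof -
    have "0 < \<sigma> j" "0 < c (b j)" using that W b \<sigma> c by auto
    then show ?thesis by simp
  qed
  have cosh1: "1 < cosh ((c (b j))\<^sup>2 / (\<sigma> j)\<^sup>2)" if "j \<in> W" for j
    using cosh_real_strict_mono[OF _ zpos[OF that]] by simp
  have fpos: "0 < f j" if "j \<in> W" for j using cosh1[OF that] by (simp add: f_def)
  have sumf: "0 < (\<Sum>k\<in>B i. f k)" if "i \<in> I" for i
    using fpos finB ne[OF that] by (intro sum_pos) (auto simp: B_def)
  have block: "1 + (\<Sum>j\<in>B i. (q j)\<^sup>2 * (cosh ((c i)\<^sup>2 / (\<sigma> j)\<^sup>2) - 1))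
      \<le> 1 + y i / (1 - real (card (B i)) * y i / 6)" if i: "i \<in> I" for i
  proof -
    let ?F = "\<Sum>k\<in>B i. f k"
    have "(\<Sum>j\<in>B i. (q j)\<^sup>2 * (cosh ((c i)\<^sup>2 / (\<sigma> j)\<^sup>2) - 1)) = (\<Sum>j\<in>B i. f j / ?F\<^sup>2)"
    proof (rule sum.cong[OF refl])
      fix j assume "j \<in> B i"
      then have j: "j \<in> W" "b j = i" by (auto simp: B_def)
      have "(q j)\<^sup>2 * (cosh ((c i)\<^sup>2 / (\<sigma> j)\<^sup>2) - 1) = (f j / ?F)\<^sup>2 * (1 / f j)"
        using j by (simp add: q_def f_def)
      also have "\<dots> = f j / ?F\<^sup>2" using fpos[OF j(1)] by (simp add: power2_eq_square)
      finally show "(q j)\<^sup>2 * (cosh ((c i)\<^sup>2 / (\<sigma> j)\<^sup>2) - 1) = f j / ?F\<^sup>2" .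
    qed
    also have "\<dots> = 1 / ?F"
      using sumf[OF i] by (simp add: power2_eq_square flip: sum_divide_distrib)
    also have "\<dots> \<le> y i / (1 - real (card (B i)) * y i / 6)"
    proof -
      define Q where "Q = (\<Sum>j\<in>B i. (\<sigma> j) ^ 4)"
      have Q: "0 < Q" unfolding Q_def using finB ne[OF i] \<sigma> W
        by (intro sum_pos zero_less_power) (auto simp: B_def)
      have y: "y i = (c i) ^ 4 / (2 * Q)" by (simp add: y_def Q_def)
      have ypos: "0 < y i" using c[OF i] Q by (simp add: y)
      have "1 / y i - real (card (B i)) / 6 = 2 * Q / (c i) ^ 4 - real (card (B i)) * (1 / 6)"
        by (simp add: y)
      also have "\<dots> = (\<Sum>j\<in>B i. 2 * (\<sigma> j) ^ 4 / (c i) ^ 4 - 1 / 6)"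
        by (simp only: Q_def sum_subtractf sum_distrib_left sum_divide_distrib sum_constant)
      also have "\<dots> \<le> ?F"
      proof (rule sum_mono)
        fix j assume "j \<in> B i"
        then have j: "j \<in> W" "b j = i" by (auto simp: B_def)
        have "((c i)\<^sup>2 / (\<sigma> j)\<^sup>2)\<^sup>2 = (c i) ^ 4 / (\<sigma> j) ^ 4"
          by (simp add: power_divide flip: power_mult)
        with inverse_cosh_minus_1_ge[OF zpos[OF j(1)]] j
        show "2 * (\<sigma> j) ^ 4 / (c i) ^ 4 - 1 / 6 \<le> f j" by (simp add: f_def)
      qed
      finally have "1 / y i - real (card (B i)) / 6 \<le> ?F" .
      moreover have "0 < 1 / y i - real (card (B i)) / 6"
        using small[OF i] ypos by (simp add: field_simps)
      ultimately have "1 / ?F \<le> 1 / (1 / y i - real (card (B i)) / 6)"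
        by (intro divide_left_mono) auto
      also have "\<dots> = y i / (1 - real (card (B i)) * y i / 6)"
        using ypos small[OF i] by (simp add: divide_simps)
      finally show ?thesis .
    qed
    finally show ?thesis by simp
  qed
  show ?thesis
  proof (rule minimax_rate_ge_of_block_prior[where W=W and I=I and b=b and q=q and c=c and A=A])
    show "0 \<le> q j" if "j \<in> W" for j
      using fpos[OF that] sumf[of "b j"] that b by (auto simp: q_def intro!: divide_nonneg_nonneg less_imp_le)
    show "(\<Sum>j | j \<in> W \<and> b j = i. q j) = 1" if "i \<in> I" for i
    proof -
      have "(\<Sum>j\<in>B i. q j) = (\<Sum>j\<in>B i. f j / (\<Sum>k\<in>B i. f k))"
        by (intro sum.cong refl) (auto simp: q_def B_def)
      also have "\<dots> = 1" using sumf[OF that] by (simp flip: sum_divide_distrib)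
      finally show ?thesis by (simp add: B_def)
    qed
    show "A powr p * (\<Sum>i\<in>I. c i powr p) \<le> R powr p"
      using sum_powr_le_of_sum_squares[OF I c p A(1) R x(1)] x(2) \<rho>(2) by simp
    have "(\<Prod>i\<in>I. 1 + (\<Sum>j\<in>B i. (q j)\<^sup>2 * (cosh ((c i)\<^sup>2 / (\<sigma> j)\<^sup>2) - 1)))
        \<le> (\<Prod>i\<in>I. 1 + y i / (1 - real (card (B i)) * y i / 6))"
    proof (rule prod_mono)
      fix i assume i: "i \<in> I"
      have "0 \<le> (\<Sum>j\<in>B i. (q j)\<^sup>2 * (cosh ((c i)\<^sup>2 / (\<sigma> j)\<^sup>2) - 1))"
        by (intro sum_nonneg mult_nonneg_nonneg) (auto simp: cosh_real_ge_1)
      with block[OF i] show "0 \<le> 1 + (\<Sum>j\<in>B i. (q j)\<^sup>2 * (cosh ((c i)\<^sup>2 / (\<sigma> j)\<^sup>2) - 1)) \<and>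
        1 + (\<Sum>j\<in>B i. (q j)\<^sup>2 * (cosh ((c i)\<^sup>2 / (\<sigma> j)\<^sup>2) - 1))
        \<le> 1 + y i / (1 - real (card (B i)) * y i / 6)" by simp
    qed
    also note chi
    finally show "(\<Prod>i\<in>I. 1 + (\<Sum>j | j \<in> W \<and> b j = i. (q j)\<^sup>2 * (cosh ((c i)\<^sup>2 / (\<sigma> j)\<^sup>2) - 1))) \<le> 1 + e\<^sup>2"
      by (simp add: B_def)
  qed (use \<sigma> a p W I b c \<rho> A e \<alpha>\<beta> in \<open>auto simp: less_imp_le\<close>)
qed

section \<open>Blocks from residue classes\<close>

text \<open>
  Positions \<open>q < N\<close> in increasing order of the noise level are dealt out cyclically to \<open>m\<close> blocks.
  The blocks have almost equal sizes, and their least noisy positions are \<open>0, \<dots>, m - 1\<close>.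
\<close>

definition residue_block :: "nat \<Rightarrow> nat \<Rightarrow> nat \<Rightarrow> nat set" where
  "residue_block N m i = {q. q < N \<and> q mod m = i}"

lemma residue_block_card:
  assumes "i < m" "k * m \<le> N" "N \<le> l * m"
  shows "finite (residue_block N m i)" "k \<le> card (residue_block N m i)" "card (residue_block N m i) \<le> l"
proof -
  show fin: "finite (residue_block N m i)" by (simp add: residue_block_def)
  have inj: "inj_on (\<lambda>x. i + x * m) X" for X using assms(1) by (auto simp: inj_on_def)
  have "(\<lambda>x. i + x * m) ` {..<k} \<subseteq> residue_block N m i"
  proof clarsimp
    fix x assume "x < k"
    then have "(x + 1) * m \<le> k * m" by (intro mult_le_mono1) simp
    then have "i + x * m < N" using assms(1,2) by simp
    then show "i + x * m \<in> residue_block N m i" using assms(1) by (simp add: residue_block_def)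
  qed
  from card_mono[OF fin this] show "k \<le> card (residue_block N m i)"
    by (simp add: card_image[OF inj])
  have "residue_block N m i \<subseteq> (\<lambda>x. i + x * m) ` {..<l}"
  proof
    fix q assume "q \<in> residue_block N m i"
    then have q: "q < N" "q mod m = i" by (auto simp: residue_block_def)
    then have "q = i + q div m * m" by (metis mod_div_mult_eq)
    moreover have "q div m < l" using q(1) assms(3) by (simp add: less_mult_imp_div_less)
    ultimately show "q \<in> (\<lambda>x. i + x * m) ` {..<l}" by blast
  qed
  then show "card (residue_block N m i) \<le> l"
    using card_mono[of "(\<lambda>x. i + x * m) ` {..<l}"] by (simp add: card_image[OF inj])
qed

lemma sum_residue_blocks:
  fixes f :: "nat \<Rightarrow> real"
  assumes "0 < m"
  shows "(\<Sum>i<m. \<Sum>q\<in>residue_block N m i. f q) = (\<Sum>q<N. f q)"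
proof -
  have "(\<lambda>q. q mod m) ` {..<N} \<subseteq> {..<m}" using assms by auto
  from sum.group[OF _ _ this, of f] show ?thesis by (simp add: residue_block_def)
qed

text \<open>
  Superadditivity of \<open>ln ((1 + y) / (1 - y))\<close> on \<open>[0, 1)\<close>.
\<close>

lemma prod_ratio_le:
  fixes y :: "'i \<Rightarrow> real"
  assumes "finite I" "\<And>i. i \<in> I \<Longrightarrow> 0 \<le> y i" "(\<Sum>i\<in>I. y i) < 1"
  shows "(\<Prod>i\<in>I. (1 + y i) / (1 - y i)) \<le> (1 + (\<Sum>i\<in>I. y i)) / (1 - (\<Sum>i\<in>I. y i))"
  using assms
proof (induction I rule: finite_induct)
  case empty
  then show ?case by simp
next
  case (insert j I)
  let ?s = "\<Sum>i\<in>I. y i"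
  have s: "0 \<le> ?s" using insert.prems(1) by (intro sum_nonneg) auto
  have yj: "0 \<le> y j" using insert.prems(1) by simp
  have lt: "y j + ?s < 1" using insert by simp
  have IH: "(\<Prod>i\<in>I. (1 + y i) / (1 - y i)) \<le> (1 + ?s) / (1 - ?s)"
  proof (rule insert.IH)
    show "?s < 1" using lt yj by linarith
  qed (use insert.prems in auto)
  have "(\<Prod>i\<in>insert j I. (1 + y i) / (1 - y i)) = (1 + y j) / (1 - y j) * (\<Prod>i\<in>I. (1 + y i) / (1 - y i))"
    using insert by simp
  also have "\<dots> \<le> (1 + y j) / (1 - y j) * ((1 + ?s) / (1 - ?s))"
    using yj s lt by (intro mult_left_mono IH divide_nonneg_nonneg) auto
  also have "\<dots> \<le> (1 + (y j + ?s)) / (1 - (y j + ?s))"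
  proof -
    have "(1 + (y j + ?s)) * ((1 - y j) * (1 - ?s)) - (1 + y j) * (1 + ?s) * (1 - (y j + ?s))
        = 2 * (y j * ?s) * (y j + ?s)"
      by (simp add: algebra_simps)
    moreover have "0 \<le> 2 * (y j * ?s) * (y j + ?s)" using yj s by simp
    ultimately have "(1 + y j) * (1 + ?s) * (1 - (y j + ?s)) \<le> (1 + (y j + ?s)) * ((1 - y j) * (1 - ?s))"
      by linarith
    moreover have "0 < (1 - y j) * (1 - ?s)" using yj s lt by simp
    ultimately show ?thesis using lt by (simp add: divide_simps)
  qed
  finally show ?case using insert by simp
qed

text \<open>
  The sizes are \<open>q\<close> or \<open>q + 1\<close> with \<open>q \<ge> 3\<close>. At these two integers \<open>1 / n\<close> agrees with an affine
  function of \<open>n\<close>, so the sum depends on \<open>N\<close> and \<open>m\<close> only; by the arithmetic-geometric mean inequality the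
  loss against equal sizes is at most the factor \<open>1 + 1 / (4 q (q + 1)) \<le> 49 / 48\<close>.
\<close>

lemma sum_inverse_block_size_le:
  assumes m: "0 < m" and N: "3 * m \<le> N"
  shows "(\<Sum>i<m. 1 / real (card (residue_block N m i))) \<le> 49 / 48 * ((real m)\<^sup>2 / real N)"
proof -
  define q where "q = N div m"
  have q: "3 \<le> q" using div_le_mono[OF N, of m] m by (simp add: q_def)
  have qm: "q * m \<le> N" "N \<le> (q + 1) * m"
  proof -
    have "q * m + N mod m = N" "N mod m < m" using m by (simp_all add: q_def)
    moreover have "(q + 1) * m = q * m + m" by simp
    ultimately show "q * m \<le> N" and "N \<le> (q + 1) * m" by linarith+
  qed
  define n where "n i = card (residue_block N m i)" for i
  have n: "n i = q \<or> n i = q + 1" if "i < m" for i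
    using residue_block_card(2,3)[OF that qm] by (auto simp: n_def)
  have "(\<Sum>i<m. n i) = N"
    using sum_residue_blocks[OF m, of "\<lambda>_. 1" N] by (simp add: n_def flip: of_nat_sum)
  then have sn: "(\<Sum>i<m. real (n i)) = real N" by (simp flip: of_nat_sum)
  let ?q = "real q"
  have "(\<Sum>i<m. 1 / real (n i)) = (\<Sum>i<m. (2 * ?q + 1 - real (n i)) / (?q * (?q + 1)))"
  proof (rule sum.cong[OF refl])
    fix i assume "i \<in> {..<m}"
    moreover have "1 / x = (2 * x + 1 - x) / (x * (x + 1))"
      "1 / (x + 1) = (2 * x + 1 - (x + 1)) / (x * (x + 1))" if "0 < x" for x :: real
      using that by (simp_all add: divide_simps)
    from this[of ?q] have "1 / ?q = (2 * ?q + 1 - ?q) / (?q * (?q + 1))"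
      "1 / (?q + 1) = (2 * ?q + 1 - (?q + 1)) / (?q * (?q + 1))" using q by simp_all
    ultimately show "1 / real (n i) = (2 * ?q + 1 - real (n i)) / (?q * (?q + 1))"
      using n[of i] by (auto simp: add.commute)
  qed
  also have "\<dots> = (real m * (2 * ?q + 1) - real N) / (?q * (?q + 1))"
    by (simp add: sum_subtractf sn flip: sum_divide_distrib)
  also have "\<dots> \<le> 49 / 48 * ((real m)\<^sup>2 / real N)"
  proof -
    have "4 * (real N * (real m * (2 * ?q + 1) - real N)) \<le> (real m * (2 * ?q + 1))\<^sup>2"
      using zero_le_power2[of "real m * (2 * ?q + 1) - 2 * real N"]
      by (simp add: power2_eq_square algebra_simps)
    also have "\<dots> = (real m)\<^sup>2 * (4 * (?q * (?q + 1)) + 1)"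
      by (simp add: power2_eq_square algebra_simps)
    also have "\<dots> \<le> (real m)\<^sup>2 * (4 * (49 / 48) * (?q * (?q + 1)))"
    proof (rule mult_left_mono)
      have "3 * 4 \<le> ?q * (?q + 1)" using q by (intro mult_mono) auto
      then show "4 * (?q * (?q + 1)) + 1 \<le> 4 * (49 / 48) * (?q * (?q + 1))" by simp
    qed simp
    finally have "real N * (real m * (2 * ?q + 1) - real N) \<le> 49 / 48 * (real m)\<^sup>2 * (?q * (?q + 1))"
      by simp
    moreover have "0 < real N" "0 < ?q * (?q + 1)" using m N q by auto
    ultimately show ?thesis by (simp add: field_simps)
  qed
  finally show ?thesis by (simp add: n_def)
qed

locale ellipsoid_testing =
  fixes J :: "nat set" and \<sigma> a :: "nat \<Rightarrow> real" and \<alpha> \<beta> p R :: real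
  assumes \<sigma>_pos: "\<And>j. j \<in> J \<Longrightarrow> 0 < \<sigma> j" and a_pos: "\<And>j. j \<in> J \<Longrightarrow> 0 < a j"
    and p: "0 < p" "p < 2" and R: "0 < R" and \<alpha>\<beta>: "\<alpha> + \<beta> \<le> 0.59"
begin

abbreviation "rate \<equiv> minimax_rate J \<sigma> (lp_ellipsoid J a p R) \<alpha> \<beta>"

text \<open>
  The constant \<open>0.82\<close> comes from \<open>0.59 + 0.82 / 2 = 1\<close>.
\<close>

lemma rate_ge_of_residue_blocks:
  assumes e: "inj_on e {..<N}" "e ` {..<N} \<subseteq> J" and A: "0 < A" "\<And>q. q < N \<Longrightarrow> a (e q) \<le> A"
    and m: "0 < m" "m \<le> N" and c: "\<And>i. i < m \<Longrightarrow> 0 < c i"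
    and \<rho>: "0 \<le> \<rho>" "(\<Sum>i<m. (c i)\<^sup>2) = \<rho>\<^sup>2"
    and x: "real m \<le> x" "\<rho>\<^sup>2 \<le> x powr (1 - 2 / p) * R\<^sup>2 / A\<^sup>2"
  defines "y \<equiv> \<lambda>i. (c i) ^ 4 / (2 * (\<Sum>q\<in>residue_block N m i. (\<sigma> (e q)) ^ 4))"
  assumes small: "\<And>i. i < m \<Longrightarrow> real (card (residue_block N m i)) * y i < 6"
    and chi: "(\<Prod>i<m. 1 + y i / (1 - real (card (residue_block N m i)) * y i / 6)) \<le> 1 + 0.82\<^sup>2"
  shows "ereal \<rho> \<le> rate"
proof -
  define b where "b j = inv_into {..<N} e j mod m" for j
  have be: "b (e q) = q mod m" if "q < N" for q
    using that e(1) by (simp add: b_def inv_into_f_f)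
  have B: "{j \<in> e ` {..<N}. b j = i} = e ` residue_block N m i" for i
    by (auto simp: residue_block_def be)
  have inj: "inj_on e (residue_block N m i)" for i
    using e(1) by (rule inj_on_subset) (auto simp: residue_block_def)
  have bim: "b ` e ` {..<N} = {..<m}"
  proof
    show "b ` e ` {..<N} \<subseteq> {..<m}" using m by (auto simp: be)
    show "{..<m} \<subseteq> b ` e ` {..<N}"
    proof
      fix i assume "i \<in> {..<m}"
      then have "b (e i) = i" "i \<in> {..<N}" using m be[of i] by auto
      then show "i \<in> b ` e ` {..<N}" by (metis imageI)
    qed
  qed
  have sums: "(\<Sum>j\<in>{j \<in> e ` {..<N}. b j = i}. (\<sigma> j) ^ 4) = (\<Sum>q\<in>residue_block N m i. (\<sigma> (e q)) ^ 4)" for i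
    unfolding B by (subst sum.reindex[OF inj]) simp
  have cards: "card {j \<in> e ` {..<N}. b j = i} = card (residue_block N m i)" for i
    unfolding B by (rule card_image[OF inj])
  show ?thesis
  proof (rule minimax_rate_ge_of_blocks[where W="e ` {..<N}" and b=b and I="{..<m}" and c=c
        and A=A and x=x and e="0.82"])
    show "\<alpha> + \<beta> + 0.82 / 2 \<le> 1" using \<alpha>\<beta> by simp
    show "real (card {j \<in> e ` {..<N}. b j = i}) *
        (c i ^ 4 / (2 * (\<Sum>j\<in>{j \<in> e ` {..<N}. b j = i}. \<sigma> j ^ 4))) < 6" if "i \<in> {..<m}" for i
      using small[of i] that by (simp only: cards sums y_def lessThan_iff)
    show "(\<Prod>i<m. 1 + c i ^ 4 / (2 * (\<Sum>j\<in>{j \<in> e ` {..<N}. b j = i}. \<sigma> j ^ 4)) /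
        (1 - real (card {j \<in> e ` {..<N}. b j = i}) *
          (c i ^ 4 / (2 * (\<Sum>j\<in>{j \<in> e ` {..<N}. b j = i}. \<sigma> j ^ 4))) / 6)) \<le> 1 + 0.82\<^sup>2"
      using chi by (simp only: cards sums y_def)
  qed (use \<sigma>_pos a_pos p R e A m bim c \<rho> x in auto)
qed

text \<open>
  With squared amplitudes proportional to the block sums of \<open>\<sigma> ^ 4\<close>, the quantities \<open>y i\<close> add up to
  \<open>\<rho> ^ 4 / (2 Q) \<le> 1 / 2\<close>, where \<open>Q\<close> is the sum of all \<open>\<sigma> ^ 4\<close>. For blocks of size at most \<open>3\<close> the
  second moment of a block is at most \<open>(1 + y / 2) / (1 - y / 2)\<close>; by superadditivity the product
  is largest when one block carries everything, which gives \<open>5 / 3 \<le> 1 + 0.82\<^sup>2\<close>.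
\<close>

lemma rate_ge_of_short_blocks:
  assumes e: "inj_on e {..<N}" "e ` {..<N} \<subseteq> J" and A: "0 < A" "\<And>q. q < N \<Longrightarrow> a (e q) \<le> A"
    and m: "0 < m" "m \<le> N" "N \<le> 3 * m" and \<rho>: "0 < \<rho>"
    and x: "real m \<le> x" "\<rho>\<^sup>2 \<le> x powr (1 - 2 / p) * R\<^sup>2 / A\<^sup>2"
    and le: "\<rho> ^ 4 \<le> (\<Sum>q<N. (\<sigma> (e q)) ^ 4)"
  shows "ereal \<rho> \<le> rate"
proof -
  define Qi where "Qi i = (\<Sum>q\<in>residue_block N m i. (\<sigma> (e q)) ^ 4)" for i
  define Q where "Q = (\<Sum>q<N. (\<sigma> (e q)) ^ 4)"
  define n where "n i = card (residue_block N m i)" for i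
  have n: "1 \<le> n i" "n i \<le> 3" if "i < m" for i
    using residue_block_card(2,3)[OF that, of 1 N 3] m by (auto simp: n_def)
  have \<sigma>e: "0 < \<sigma> (e q)" if "q < N" for q using that e(2) by (intro \<sigma>_pos) auto
  have Qi: "0 < Qi i" if "i < m" for i
  proof -
    have "residue_block N m i \<noteq> {}" using n(1)[OF that] by (auto simp: n_def)
    moreover have "0 < \<sigma> (e q)" if "q \<in> residue_block N m i" for q
      using that by (intro \<sigma>e) (simp add: residue_block_def)
    moreover have "finite (residue_block N m i)" by (simp add: residue_block_def)
    ultimately show ?thesis unfolding Qi_def by (intro sum_pos zero_less_power)
  qed
  have sumQ: "(\<Sum>i<m. Qi i) = Q"
    unfolding Qi_def Q_def using m(1) by (rule sum_residue_blocks)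
  have Q: "0 < Q" unfolding Q_def using m \<sigma>e by (intro sum_pos zero_less_power) (auto simp: lessThan_empty_iff)
  define c where "c i = \<rho> * sqrt (Qi i / Q)" for i
  define y where "y i = (c i) ^ 4 / (2 * Qi i)" for i
  have c2: "(c i)\<^sup>2 = \<rho>\<^sup>2 * (Qi i / Q)" if "i < m" for i
    using Qi[OF that] Q by (simp add: c_def power_mult_distrib)
  have y: "y i = \<rho> ^ 4 / Q * Qi i / Q / 2" if "i < m" for i
  proof -
    have "(c i) ^ 4 = ((c i)\<^sup>2)\<^sup>2" by (simp flip: power_mult)
    also have "\<dots> = (\<rho>\<^sup>2 * (Qi i / Q))\<^sup>2" by (simp only: c2[OF that])
    also have "\<dots> = \<rho> ^ 4 * Qi i * Qi i / (Q * Q)"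
      by (simp add: power2_eq_square power4_eq_xxxx)
    finally show ?thesis using Qi[OF that] by (simp add: y_def)
  qed
  have y0: "0 < y i" if "i < m" for i using y[OF that] Qi[OF that] Q \<rho> by simp
  have "(\<Sum>i<m. y i / 2) = (\<Sum>i<m. \<rho> ^ 4 / Q * Qi i / Q / 2 / 2)"
    by (intro sum.cong refl) (simp add: y)
  also have "\<dots> = \<rho> ^ 4 / Q * (\<Sum>i<m. Qi i) / Q / 2 / 2"
    by (simp add: sum_distrib_left sum_divide_distrib)
  also have "\<dots> \<le> 1 / 4" using le Q unfolding sumQ by (simp add: Q_def field_simps)
  finally have ysum: "(\<Sum>i<m. y i / 2) \<le> 1 / 4" .
  have y_le: "y i / 2 \<le> 1 / 4" if "i < m" for i
    using member_le_sum[of i "{..<m}" "\<lambda>i. y i / 2"] that y0 ysum by (force simp: less_imp_le)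
  have n_le: "real (n i) * y i \<le> 3 * y i" if "i < m" for i
    using n[OF that] y0[OF that] by (intro mult_right_mono) auto
  show ?thesis
  proof (rule rate_ge_of_residue_blocks[OF e A m(1,2), where c=c and x=x])
    show "0 < c i" if "i < m" for i using Qi[OF that] Q \<rho> by (simp add: c_def)
    have "(\<Sum>i<m. (c i)\<^sup>2) = \<rho>\<^sup>2 * ((\<Sum>i<m. Qi i) / Q)"
      by (simp add: c2 sum_distrib_left sum_divide_distrib)
    then show "(\<Sum>i<m. (c i)\<^sup>2) = \<rho>\<^sup>2" using Q by (simp add: sumQ)
    show "real (card (residue_block N m i)) * (c i ^ 4 / (2 * (\<Sum>q\<in>residue_block N m i. \<sigma> (e q) ^ 4))) < 6"
      if "i < m" for i
    proof -
      have "real (n i) * y i < 6" using n_le[OF that] y_le[OF that] by linarith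
      then show ?thesis by (simp only: n_def y_def Qi_def)
    qed
    have "(\<Prod>i<m. 1 + y i / (1 - real (n i) * y i / 6)) \<le> (\<Prod>i<m. (1 + y i / 2) / (1 - y i / 2))"
    proof (rule prod_mono, safe)
      fix i assume i: "i < m"
      note le = n_le[OF i] y_le[OF i] y0[OF i]
      then have d: "0 < 1 - real (n i) * y i / 6" "0 < 1 - y i / 2"
        "1 - y i / 2 \<le> 1 - real (n i) * y i / 6" by linarith+
      have "y i / (1 - real (n i) * y i / 6) \<le> y i / (1 - y i / 2)"
        by (rule divide_left_mono[OF d(3) less_imp_le[OF y0[OF i]] mult_pos_pos[OF d(1,2)]])
      also have "1 + y i / (1 - y i / 2) = (1 + y i / 2) / (1 - y i / 2)"
        using d(2) by (simp add: field_simps)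
      finally show "1 + y i / (1 - real (n i) * y i / 6) \<le> (1 + y i / 2) / (1 - y i / 2)" by simp
      have "0 \<le> y i / (1 - real (n i) * y i / 6)" by (rule divide_nonneg_pos[OF less_imp_le[OF y0[OF i]] d(1)])
      then show "0 \<le> 1 + y i / (1 - real (n i) * y i / 6)" by simp
    qed
    also have "\<dots> \<le> (1 + (\<Sum>i<m. y i / 2)) / (1 - (\<Sum>i<m. y i / 2))"
      using y0 ysum by (intro prod_ratio_le) (auto simp: less_imp_le)
    also have "\<dots> \<le> (1 + 1 / 4) / (1 - 1 / 4)"
      using ysum y0 by (intro frac_le) (auto intro!: add_nonneg_nonneg sum_nonneg simp: less_imp_le)
    also have "\<dots> \<le> 1 + 0.82\<^sup>2" by (simp add: power2_eq_square)
    finally show "(\<Prod>i<m. 1 + c i ^ 4 / (2 * (\<Sum>q\<in>residue_block N m i. \<sigma> (e q) ^ 4)) /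
        (1 - real (card (residue_block N m i)) *
          (c i ^ 4 / (2 * (\<Sum>q\<in>residue_block N m i. \<sigma> (e q) ^ 4))) / 6)) \<le> 1 + 0.82\<^sup>2"
      by (simp add: n_def y_def Qi_def)
  qed (use \<rho> x in auto)
qed

lemma exp_49_96_le: "exp (49 / 96) \<le> (1 + 0.82\<^sup>2 :: real)"
proof -
  have "(exp (1 / 2 :: real))\<^sup>2 = exp 1" by (simp flip: exp_double)
  also have "\<dots> \<le> 1.65\<^sup>2" using e_less_272 by (simp add: power2_eq_square)
  finally have 1: "exp (1 / 2 :: real) \<le> 1.65" by (rule power2_le_imp_le) simp
  have "1 - 1 / 96 \<le> exp (- 1 / 96 :: real)" using exp_ge_add_one_self[of "- 1 / 96 :: real"] by simp
  then have "exp (1 / 96 :: real) \<le> 96 / 95"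
    by (simp add: exp_minus field_simps)
  with 1 have "exp (1 / 2) * exp (1 / 96) \<le> 1.65 * (96 / 95 :: real)" by (intro mult_mono) auto
  then show ?thesis by (simp add: power2_eq_square flip: exp_add)
qed

text \<open>
  Here the squared amplitude of a block is proportional to its smallest variance, so that no position
  of a block is easier to detect than its first one and a block of size \<open>n\<close> contributes
  about \<open>L / (2 n)\<close> to the logarithm of the second moment. The hypothesis on \<open>L\<close> says that equal
  block sizes would give a total of at most \<open>1 / 2\<close>; the actual sizes cost the factor \<open>49 / 48\<close>.
\<close>

lemma rate_ge_of_long_blocks:
  assumes e: "inj_on e {..<N}" "e ` {..<N} \<subseteq> J" and A: "0 < A" "\<And>q. q < N \<Longrightarrow> a (e q) \<le> A"
    and sorted: "\<And>q r. q \<le> r \<Longrightarrow> r < N \<Longrightarrow> \<sigma> (e q) \<le> \<sigma> (e r)"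
    and m: "0 < m" "3 * m \<le> N" and \<rho>: "0 < \<rho>"
    and x: "real m \<le> x" "\<rho>\<^sup>2 \<le> x powr (1 - 2 / p) * R\<^sup>2 / A\<^sup>2"
    and L: "0 \<le> L" "\<rho> ^ 4 \<le> L * (\<Sum>q<m. (\<sigma> (e q))\<^sup>2)\<^sup>2" "(real m)\<^sup>2 * L \<le> real N * (1 - L / 12)"
  shows "ereal \<rho> \<le> rate"
proof -
  define H where "H = (\<Sum>q<m. (\<sigma> (e q))\<^sup>2)"
  define n where "n i = card (residue_block N m i)" for i
  have n: "3 \<le> n i" if "i < m" for i
    using residue_block_card(2)[OF that, of 3 N N] m by (auto simp: n_def)
  have \<sigma>e: "0 < \<sigma> (e q)" if "q < N" for q using that e(2) by (intro \<sigma>_pos) auto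
  have H: "0 < H" unfolding H_def using m \<sigma>e by (intro sum_pos zero_less_power) (auto simp: lessThan_empty_iff)
  have L12: "L < 12"
  proof (rule ccontr)
    assume "\<not> L < 12"
    then have "0 < (real m)\<^sup>2 * L" "real N * (1 - L / 12) \<le> 0"
      using m by (auto simp: mult_nonneg_nonpos)
    with L(3) show False by simp
  qed
  define c where "c i = \<rho> * \<sigma> (e i) / sqrt H" for i
  have c2: "(c i)\<^sup>2 = \<rho>\<^sup>2 * (\<sigma> (e i))\<^sup>2 / H" for i
    using H by (simp add: c_def power_mult_distrib power_divide)
  define Qi where "Qi i = (\<Sum>q\<in>residue_block N m i. (\<sigma> (e q)) ^ 4)" for i
  define y where "y i = (c i) ^ 4 / (2 * Qi i)" for i
  have Qi: "real (n i) * (\<sigma> (e i)) ^ 4 \<le> Qi i" if "i < m" for i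
  proof -
    have "(\<Sum>q\<in>residue_block N m i. (\<sigma> (e i)) ^ 4) \<le> Qi i"
      unfolding Qi_def
    proof (intro sum_mono power_mono)
      fix q assume "q \<in> residue_block N m i"
      then have "q < N" "i \<le> q" by (auto simp: residue_block_def)
      then show "\<sigma> (e i) \<le> \<sigma> (e q)" "0 \<le> \<sigma> (e i)" using sorted \<sigma>e[of i] by auto
    qed
    then show ?thesis by (simp add: n_def)
  qed
  have y: "0 < y i" "real (n i) * y i \<le> L / 2" if i: "i < m" for i
  proof -
    have \<sigma>i: "0 < \<sigma> (e i)" using i m by (intro \<sigma>e) auto
    have npos: "0 < real (n i)" using n[OF i] by simp
    have Qpos: "0 < Qi i" using Qi[OF i] npos \<sigma>i by (smt (verit) mult_pos_pos zero_less_power)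
    show "0 < y i" using \<sigma>i H Qpos \<rho> by (simp add: y_def c_def)
    have "(c i) ^ 4 = (\<rho>\<^sup>2 * (\<sigma> (e i))\<^sup>2 / H)\<^sup>2" by (simp flip: c2 power_mult)
    also have "\<dots> = \<rho> ^ 4 * (\<sigma> (e i)) ^ 4 / H\<^sup>2"
      by (simp add: power_divide power_mult_distrib flip: power_mult)
    also have "\<dots> \<le> (L * H\<^sup>2) * (\<sigma> (e i)) ^ 4 / H\<^sup>2"
      using L(2) \<sigma>i by (intro divide_right_mono mult_right_mono) (auto simp: H_def)
    also have "\<dots> = L * (\<sigma> (e i)) ^ 4" using H by simp
    finally have "real (n i) * (c i) ^ 4 \<le> L * (real (n i) * (\<sigma> (e i)) ^ 4)"
      using mult_left_mono[of "(c i) ^ 4" "L * (\<sigma> (e i)) ^ 4" "real (n i)"] by (simp add: mult_ac)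
    also have "\<dots> \<le> L * Qi i" using Qi[OF i] L(1) by (rule mult_left_mono)
    finally show "real (n i) * y i \<le> L / 2" using Qpos by (simp add: y_def field_simps)
  qed
  show ?thesis
  proof (rule rate_ge_of_residue_blocks[OF e A m(1), where c=c and x=x])
    show "0 < c i" if "i < m" for i using \<sigma>e[of i] that m H \<rho> by (simp add: c_def)
    have "(\<Sum>i<m. (c i)\<^sup>2) = \<rho>\<^sup>2 * H / H"
      by (simp add: c2 H_def flip: sum_distrib_left sum_divide_distrib)
    then show "(\<Sum>i<m. (c i)\<^sup>2) = \<rho>\<^sup>2" using H by simp
    show "real (card (residue_block N m i)) * (c i ^ 4 / (2 * (\<Sum>q\<in>residue_block N m i. \<sigma> (e q) ^ 4))) < 6"
      if "i < m" for i
    proof -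
      have "real (n i) * y i < 6" using y(2)[OF that] L12 by linarith
      then show ?thesis by (simp only: n_def y_def Qi_def)
    qed
    define C where "C = L / 2 / (1 - L / 12)"
    have C: "0 \<le> C" using L12 L(1) by (simp add: C_def)
    have "(\<Prod>i<m. 1 + y i / (1 - real (n i) * y i / 6)) \<le> (\<Prod>i<m. exp (C * (1 / real (n i))))"
    proof (rule prod_mono, safe)
      fix i assume i: "i < m"
      note le = y[OF i]
      have "0 \<le> y i / (1 - real (n i) * y i / 6)" using le L12 by (intro divide_nonneg_nonneg) auto
      then show "0 \<le> 1 + y i / (1 - real (n i) * y i / 6)" by simp
      have "y i / (1 - real (n i) * y i / 6) \<le> (L / 2 / real (n i)) / (1 - L / 12)"
        using le L12 L(1) n[OF i] by (intro frac_le) (auto simp: field_simps)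
      also have "\<dots> = C * (1 / real (n i))" by (simp add: C_def)
      finally show "1 + y i / (1 - real (n i) * y i / 6) \<le> exp (C * (1 / real (n i)))"
        using exp_ge_add_one_self[of "C * (1 / real (n i))"] by linarith
    qed
    also have "\<dots> = exp (C * (\<Sum>i<m. 1 / real (n i)))"
      by (simp add: exp_sum sum_distrib_left)
    also have "C * (\<Sum>i<m. 1 / real (n i)) \<le> C * (49 / 48 * ((real m)\<^sup>2 / real N))"
      using sum_inverse_block_size_le[OF m] C unfolding n_def by (intro mult_left_mono)
    also have "\<dots> = 49 / 96 * (((real m)\<^sup>2 * L) / (real N * (1 - L / 12)))"
    proof -
      have "l / 2 / d * (49 / 48 * (x / k)) = 49 / 96 * ((x * l) / (k * d))" for l d x k :: real
        by (simp add: mult_ac)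
      then show ?thesis by (simp only: C_def)
    qed
    also have "\<dots> \<le> 49 / 96"
      using L(3) L12 m by (simp add: divide_le_eq mult.commute[of L])
    finally have "(\<Prod>i<m. 1 + y i / (1 - real (n i) * y i / 6)) \<le> exp (49 / 96)" by simp
    also note exp_49_96_le
    finally show "(\<Prod>i<m. 1 + c i ^ 4 / (2 * (\<Sum>q\<in>residue_block N m i. \<sigma> (e q) ^ 4)) /
        (1 - real (card (residue_block N m i)) *
          (c i ^ 4 / (2 * (\<Sum>q\<in>residue_block N m i. \<sigma> (e q) ^ 4))) / 6)) \<le> 1 + 0.82\<^sup>2"
      by (simp add: n_def y_def Qi_def)
  qed (use \<rho> x m in auto)
qed

end

section \<open>Sorted noise levels and numerical inequalities\<close>

lemma ordered_sd_enumeration: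
  obtains \<tau> where "bij_betw \<tau> {1..D} {1..D}" "\<And>j. j \<in> {1..D} \<Longrightarrow> ordered_sd \<sigma> D j = \<sigma> (\<tau> j)"
proof -
  let ?xs = "map \<sigma> [1..<Suc D]"
  obtain f where f: "f permutes {..<length ?xs}" "permute_list f ?xs = sort ?xs"
    using mset_eq_permutation[of "sort ?xs" ?xs] by auto
  have f': "f permutes {..<D}" using f(1) by (simp del: upt_Suc)
  have "bij_betw (\<lambda>j. f (j - 1) + 1) {1..D} {1..D}"
  proof -
    have 1: "bij_betw (\<lambda>j. j - 1) {1..D} {..<D}"
      by (rule bij_betwI[where g="\<lambda>j. j + 1"]) auto
    have 2: "bij_betw f {..<D} {..<D}" using f' by (rule permutes_imp_bij)
    have 3: "bij_betw (\<lambda>j. j + 1) {..<D} {1..D}"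
      by (rule bij_betwI[where g="\<lambda>j. j - 1"]) auto
    show ?thesis using bij_betw_trans[OF bij_betw_trans[OF 1 2] 3] by (simp only: comp_def)
  qed
  moreover have "ordered_sd \<sigma> D j = \<sigma> (f (j - 1) + 1)" if "j \<in> {1..D}" for j
  proof -
    have j: "j - 1 < D" using that by auto
    then have "f (j - 1) < D" using permutes_in_image[OF f', of "j - 1"] by simp
    have "ordered_sd \<sigma> D j = permute_list f ?xs ! (j - 1)"
      by (simp only: ordered_sd_def f(2))
    also have "\<dots> = ?xs ! f (j - 1)"
      using j f(1) by (intro permute_list_nth) auto
    also have "\<dots> = \<sigma> (f (j - 1) + 1)"
      using \<open>f (j - 1) < D\<close> by (simp add: nth_append del: upt_Suc)
    finally show ?thesis .
  qed
  ultimately show thesis by (rule that)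
qed

lemma ordered_sd_mono:
  assumes "1 \<le> i" "i \<le> j" "j \<le> D"
  shows "ordered_sd \<sigma> D i \<le> ordered_sd \<sigma> D j"
  unfolding ordered_sd_def using assms by (intro sorted_nth_mono) auto

lemma ceil_sqrt_bounds:
  assumes "1 \<le> D"
  shows "1 \<le> ceil_sqrt D" "ceil_sqrt D \<le> D" "D \<le> (ceil_sqrt D)\<^sup>2" "(ceil_sqrt D - 1)\<^sup>2 < D"
    "real (ceil_sqrt D - 1) \<le> sqrt (real D)"
proof -
  let ?k = "ceil_sqrt D"
  have s: "1 \<le> sqrt (real D)" using assms by simp
  have le: "sqrt (real D) \<le> real ?k" unfolding ceil_sqrt_def by (rule real_nat_ceiling_ge)
  have lt: "real ?k < sqrt (real D) + 1"
    unfolding ceil_sqrt_def using s ceiling_correct[of "sqrt (real D)"] by simp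
  have "1 \<le> real ?k" using s le by linarith
  then show k1: "1 \<le> ?k" by simp
  have kr: "real (?k - 1) = real ?k - 1" using k1 by (simp add: of_nat_diff)
  show "real (?k - 1) \<le> sqrt (real D)" using lt kr by simp
  have "real D \<le> (real ?k)\<^sup>2" using power_mono[OF le, of 2] s by simp
  then show "D \<le> ?k\<^sup>2" by (metis of_nat_le_iff of_nat_power)
  have "(real (?k - 1))\<^sup>2 < (sqrt (real D))\<^sup>2"
    using lt kr k1 by (intro power_strict_mono) auto
  then have "(real (?k - 1))\<^sup>2 < real D" by simp
  then show kD: "(?k - 1)\<^sup>2 < D" by (metis of_nat_less_iff of_nat_power)
  show "?k \<le> D"
  proof (cases "?k = 1")
    case True then show ?thesis using assms by simp
  next
    case False
    then have "?k - 1 \<le> (?k - 1)\<^sup>2" using k1 by (simp add: power2_eq_square)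
    then show ?thesis using kD by linarith
  qed
qed

text \<open>
  With \<open>x = sqrt (1 + u)\<close> this is \<open>2 ln x \<le> x - 1 / x\<close>; the difference of the two sides has
  derivative \<open>(1 - 1 / x)\<^sup>2\<close>.
\<close>

lemma ln_add_one_sq_le:
  fixes u :: real
  assumes "0 \<le> u"
  shows "(ln (1 + u))\<^sup>2 \<le> u\<^sup>2 / (1 + u)"
proof -
  let ?f = "\<lambda>x::real. x - 1 / x - 2 * ln x"
  define x where "x = sqrt (1 + u)"
  have x: "1 \<le> x" "x\<^sup>2 = 1 + u" using assms by (simp_all add: x_def)
  have "?f 1 \<le> ?f x"
  proof (rule DERIV_nonneg_imp_nondecreasing[OF x(1)])
    fix z :: real assume "1 \<le> z" "z \<le> x"
    then have "(?f has_real_derivative (1 - 1 / z)\<^sup>2) (at z)"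
      by (auto intro!: derivative_eq_intros simp: power2_eq_square field_simps)
    then show "\<exists>y. (?f has_real_derivative y) (at z) \<and> 0 \<le> y" by (intro exI conjI) auto
  qed
  then have "2 * ln x \<le> x - 1 / x" by simp
  moreover have "ln (1 + u) = 2 * ln x" using x by (simp flip: x(2) add: ln_realpow)
  moreover have "x - 1 / x = u / x"
  proof -
    have "x - 1 / x = (x\<^sup>2 - 1) / x" using x(1) by (simp add: field_simps power2_eq_square)
    then show ?thesis using x(2) by simp
  qed
  moreover have "0 \<le> ln x" using x(1) by (rule ln_ge_zero)
  ultimately have "(ln (1 + u))\<^sup>2 \<le> (u / x)\<^sup>2" by (intro power_mono) simp_all
  then show ?thesis using x(2) by (simp add: power_divide)
qed

text \<open>
  The one case, \<open>k = 3\<close>, \<open>D = 5\<close> and \<open>n = 3\<close>, in which the preceding estimate of the logarithm is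
  too weak for the next lemma. The bound \<open>1 / sqrt 3\<close> is approached closely (0.5736 against
  0.5774), so the exponential is estimated at a quarter of the argument.
\<close>

lemma ln_one_plus_sqrt_three_fifths: "9 * (ln (1 + sqrt (3 / 5)))\<^sup>2 \<le> (3 :: real)"
proof -
  have "sqrt (3 / 5) \<le> (0.7746 :: real)" by (rule real_le_lsqrt) (simp_all add: power2_eq_square)
  then have "1 + sqrt (3 / 5) \<le> (1.7746 :: real)" by simp
  also have "\<dots> \<le> (1 + 0.144325 + 0.144325\<^sup>2 / 2) ^ 4" by (simp add: power2_eq_square power4_eq_xxxx)
  also have "\<dots> \<le> (exp 0.144325) ^ 4"
    by (intro power_mono exp_lower_Taylor_quadratic) auto
  also have "\<dots> = (exp 0.5773 :: real)" by (simp flip: exp_of_nat_mult)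
  finally have le: "1 + sqrt (3 / 5) \<le> (exp 0.5773 :: real)" .
  have pos: "0 < 1 + sqrt (3 / 5 :: real)" by (rule add_pos_nonneg) simp_all
  have "ln (1 + sqrt (3 / 5)) \<le> ln (exp 0.5773 :: real)"
    using ln_le_cancel_iff[OF pos exp_gt_zero] le by blast
  then have "ln (1 + sqrt (3 / 5)) \<le> (0.5773 :: real)" by (simp only: ln_exp)
  then have "(ln (1 + sqrt (3 / 5)))\<^sup>2 \<le> (0.5773 :: real)\<^sup>2" by (intro power_mono) auto
  then show ?thesis by (simp add: power2_eq_square)
qed

text \<open>
  By the estimate of the logarithm it is enough that \<open>k\<^sup>2 \<le> D + sqrt (n D)\<close>. Now \<open>k\<^sup>2\<close> exceeds \<open>D\<close> by
  at most \<open>2 (k - 1)\<close>, while \<open>n D\<close> is at least \<open>k ((k - 1)\<^sup>2 + 1)\<close>, and \<open>4 (k - 1)\<^sup>2\<close> is at most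
  that unless \<open>k = 3\<close>.
\<close>

lemma sq_ceil_sqrt_times_ln_le:
  fixes k D n :: nat
  assumes k: "1 \<le> k" "(k - 1)\<^sup>2 < D" and n: "k \<le> n" "n \<le> D"
  shows "(real k)\<^sup>2 * (ln (1 + sqrt (real n / real D)))\<^sup>2 \<le> real n"
proof (cases "k = 3 \<and> D = 5 \<and> n = 3")
  case True
  then show ?thesis using ln_one_plus_sqrt_three_fifths by simp
next
  case False
  define u where "u = sqrt (real n / real D)"
  have D: "0 < real D" using k n by simp
  have u: "0 \<le> u" "u\<^sup>2 = real n / real D" by (simp_all add: u_def)
  have key: "(real k)\<^sup>2 \<le> real D * (1 + u)"
  proof (cases "k\<^sup>2 \<le> D")
    case True
    then have "(real k)\<^sup>2 \<le> real D" by (metis of_nat_le_iff of_nat_power)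
    moreover have "0 \<le> real D * u" using D u(1) by simp
    ultimately show ?thesis by (simp only: distrib_left mult_1_right)
  next
    case not: False
    have nD: "(k\<^sup>2 - D)\<^sup>2 \<le> n * D"
    proof -
      obtain i where i: "k = Suc i" using k(1) by (cases k) auto
      have D_ge: "i * i + 1 \<le> D" using k(2) by (simp add: i power2_eq_square)
      have diff: "k\<^sup>2 - D \<le> 2 * i" using D_ge by (simp add: i power2_eq_square)
      consider "i \<le> 1" | "i = 2" | "3 \<le> i" by linarith
      then show ?thesis
      proof cases
        case 1
        have "(k\<^sup>2 - D)\<^sup>2 \<le> (2 * i)\<^sup>2" using diff by (rule power_mono) simp
        also have "\<dots> \<le> k * (i * i + 1)" using 1 i by (cases i) auto
        also have "\<dots> \<le> n * D" using n(1) D_ge by (rule mult_le_mono)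
        finally show ?thesis .
      next
        case 2
        show ?thesis
        proof (cases "D = 5")
          case True
          then have "4 \<le> n" using False n(1) 2 i by auto
          then show ?thesis using True 2 i by simp
        next
          case D5: False
          then have "k\<^sup>2 - D \<le> 3" "6 \<le> D" using D_ge 2 i by auto
          then have "(k\<^sup>2 - D)\<^sup>2 \<le> 3\<^sup>2" by (intro power_mono) auto
          also have "\<dots> \<le> 3 * 6" by simp
          also have "\<dots> \<le> n * D" using n(1) 2 i \<open>6 \<le> D\<close> by (intro mult_le_mono) auto
          finally show ?thesis .
        qed
      next
        case 3
        have "(k\<^sup>2 - D)\<^sup>2 \<le> (2 * i)\<^sup>2" using diff by (rule power_mono) simp
        also have "\<dots> = 4 * (i * i)" by (simp add: power2_eq_square)
        also have "\<dots> \<le> k * (i * i + 1)" using 3 i by (intro mult_le_mono) auto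
        also have "\<dots> \<le> n * D" using n(1) D_ge by (rule mult_le_mono)
        finally show ?thesis .
      qed
    qed
    have "real (k\<^sup>2 - D) = (real k)\<^sup>2 - real D"
      using not by (simp only: of_nat_diff of_nat_power linear not_le less_imp_le)
    then have "((real k)\<^sup>2 - real D)\<^sup>2 = real ((k\<^sup>2 - D)\<^sup>2)"
      by (simp only: of_nat_power)
    also have "\<dots> \<le> real (n * D)" using nD by (simp only: of_nat_le_iff)
    also have "\<dots> = (real D * u)\<^sup>2"
      unfolding power_mult_distrib u(2) using D by (simp add: power2_eq_square)
    finally have "(real k)\<^sup>2 - real D \<le> real D * u"
      by (rule power2_le_imp_le) (use D u(1) in simp)
    then show ?thesis by (simp add: distrib_left)
  qed
  have "(real k)\<^sup>2 * (ln (1 + u))\<^sup>2 \<le> real D * (1 + u) * (u\<^sup>2 / (1 + u))"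
    using key ln_add_one_sq_le[OF u(1)] u(1) D by (intro mult_mono) auto
  also have "\<dots> = real D * u\<^sup>2" using u(1) by simp
  also have "\<dots> = real n" unfolding u(2) using D by simp
  finally show ?thesis by (simp add: u_def)
qed

text \<open>
  Since \<open>n \<le> D\<close>, the squared logarithm is at most \<open>n / (D + n)\<close>. What remains is a polynomial
  inequality, which follows from its instance \<open>n = 3 m + 1\<close> and is then cubic in \<open>m\<close>.
\<close>

lemma long_block_condition:
  fixes m D n :: nat and L :: real
  assumes m: "1 \<le> m" "m\<^sup>2 < D" and n: "3 * m < n" "n \<le> D"
  defines "L \<equiv> ((real m + 1) / real m)\<^sup>2 * (ln (1 + sqrt (real n / real D)))\<^sup>2"
  shows "(real m)\<^sup>2 * L \<le> real (n - 1) * (1 - L / 12)"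
proof -
  define t2 where "t2 = (ln (1 + sqrt (real n / real D)))\<^sup>2"
  define M N E where "M = real m" and "N = real n" and "E = real D"
  have M1: "1 \<le> M" using m by (simp add: M_def)
  have NM: "3 * M + 1 \<le> N" unfolding M_def N_def using n(1) by simp
  have EM: "M\<^sup>2 + 1 \<le> E"
  proof -
    have "real (m\<^sup>2 + 1) \<le> real D" using m(2) by (intro of_nat_mono) simp
    then show ?thesis by (simp add: M_def E_def)
  qed
  have EN: "N \<le> E" using n(2) by (simp add: N_def E_def)
  have pos: "0 < N" "0 < E" "0 < M" using M1 NM EN by linarith+
  have t2: "t2 \<le> N / (E + N)"
  proof -
    define u where "u = sqrt (N / E)"
    have u: "0 \<le> u" "u\<^sup>2 = N / E" "u \<le> 1" using pos EN by (simp_all add: u_def)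
    have uu: "u\<^sup>2 \<le> u" using mult_left_le[OF u(3,1)] by (simp only: power2_eq_square)
    have "t2 \<le> u\<^sup>2 / (1 + u)"
      unfolding t2_def using ln_add_one_sq_le[OF u(1)] by (simp add: u_def N_def E_def)
    also have "\<dots> \<le> u\<^sup>2 / (1 + u\<^sup>2)"
      using u uu pos by (intro divide_left_mono) (auto intro!: mult_pos_pos add_pos_nonneg)
    also have "\<dots> = N / (E + N)" using pos by (simp add: u(2) field_simps)
    finally show ?thesis .
  qed
  have poly: "(M + 1)\<^sup>2 * N * (12 * M\<^sup>2 + (N - 1)) \<le> 12 * M\<^sup>2 * (N - 1) * (E + N)"
  proof -
    \<comment> \<open>For \<open>m = 1\<close> the bound \<open>D \<ge> n \<ge> 4\<close> is needed; otherwise \<open>D \<ge> m\<^sup>2 + 1\<close> suffices.\<close>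
    have base: "4 * M * (M + 1)\<^sup>2 * (3 * M + 1) \<le> 12 * M\<^sup>2 * E + (3 * M + 1) * (12 * M\<^sup>2 - (M + 1)\<^sup>2)"
    proof (cases "m = 1")
      case True
      then have "M = 1" "4 \<le> E" using NM EN by (auto simp: M_def)
      then show ?thesis by simp
    next
      case False
      then have M2: "2 \<le> M" using m by (simp add: M_def)
      have "2 * (M * M) \<le> M * (M * M)" "2 * M \<le> M * M" using M2 by (auto intro!: mult_right_mono)
      then have "0 \<le> 5 * (M * (M * M)) - 3 * (M * M) - 9 * M - 1" using M2 by linarith
      moreover have "12 * M\<^sup>2 * (M\<^sup>2 + 1) + (3 * M + 1) * (12 * M\<^sup>2 - (M + 1)\<^sup>2)
          - 4 * M * (M + 1)\<^sup>2 * (3 * M + 1) = 5 * (M * (M * M)) - 3 * (M * M) - 9 * M - 1"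
        by (simp add: power2_eq_square algebra_simps)
      moreover have "12 * M\<^sup>2 * (M\<^sup>2 + 1) \<le> 12 * M\<^sup>2 * E" using EM by (intro mult_left_mono) auto
      ultimately show ?thesis by linarith
    qed
    have coef: "0 \<le> 12 * M\<^sup>2 - (M + 1)\<^sup>2"
    proof -
      have "(M + 1)\<^sup>2 \<le> (2 * M)\<^sup>2" using M1 by (intro power_mono) auto
      then show ?thesis by (simp add: power_mult_distrib) (use zero_le_power2[of M] in linarith)
    qed
    have "12 * M\<^sup>2 * (M + 1)\<^sup>2 * N = 4 * M * (M + 1)\<^sup>2 * (3 * M * N)"
      by (simp add: power2_eq_square)
    also have "\<dots> \<le> 4 * M * (M + 1)\<^sup>2 * ((3 * M + 1) * (N - 1))"
      using NM M1 by (intro mult_left_mono) (auto simp: algebra_simps)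
    also have "\<dots> = (4 * M * (M + 1)\<^sup>2 * (3 * M + 1)) * (N - 1)" by simp
    also have "\<dots> \<le> (12 * M\<^sup>2 * E + (3 * M + 1) * (12 * M\<^sup>2 - (M + 1)\<^sup>2)) * (N - 1)"
      using base NM M1 by (intro mult_right_mono) auto
    also have "\<dots> \<le> (12 * M\<^sup>2 * E + N * (12 * M\<^sup>2 - (M + 1)\<^sup>2)) * (N - 1)"
      using coef NM M1 by (intro mult_right_mono add_left_mono) auto
    finally show ?thesis by (simp add: algebra_simps)
  qed
  have "(M + 1)\<^sup>2 * t2 * (12 * M\<^sup>2 + (N - 1)) \<le> (M + 1)\<^sup>2 * (N / (E + N)) * (12 * M\<^sup>2 + (N - 1))"
    using t2 NM M1 by (intro mult_right_mono mult_left_mono) auto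
  also have "\<dots> = (M + 1)\<^sup>2 * N * (12 * M\<^sup>2 + (N - 1)) / (E + N)" by simp
  also have "\<dots> \<le> 12 * M\<^sup>2 * (N - 1)" using poly pos by (simp add: divide_le_eq)
  finally have fin: "(M + 1)\<^sup>2 * t2 * (12 * M\<^sup>2 + (N - 1)) \<le> 12 * M\<^sup>2 * (N - 1)" .
  have LM: "M\<^sup>2 * L = (M + 1)\<^sup>2 * t2"
    using pos by (simp add: L_def M_def t2_def power_divide)
  have "12 * M\<^sup>2 * (M\<^sup>2 * L) \<le> 12 * M\<^sup>2 * ((N - 1) * (1 - L / 12))"
  proof -
    have gen: "12 * x * (x * l) \<le> 12 * x * (y * (1 - l / 12))"
      if "x * l * (12 * x + y) \<le> 12 * x * y" for x y l :: real
    proof -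
      have "12 * x * (x * l) = x * l * (12 * x + y) - x * l * y" by (simp add: algebra_simps)
      also have "\<dots> \<le> 12 * x * y - x * l * y" using that by (rule diff_right_mono)
      also have "\<dots> = 12 * x * (y * (1 - l / 12))" by (simp add: algebra_simps)
      finally show ?thesis .
    qed
    show ?thesis using fin unfolding LM[symmetric] by (rule gen)
  qed
  then have "M\<^sup>2 * L \<le> (N - 1) * (1 - L / 12)"
    by (rule mult_left_le_imp_le) (use pos in simp)
  moreover have "real (n - 1) = N - 1" using n by (simp add: N_def of_nat_diff)
  ultimately show ?thesis by (simp add: M_def)
qed

section \<open>The two lower bounds\<close>

lemma sum_segment:
  fixes f :: "nat \<Rightarrow> real"
  shows "(\<Sum>j = l + 1..l + N. f j) = (\<Sum>q<N. f (l + 1 + q))"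
  by (rule sum.reindex_bij_witness[of _ "\<lambda>q. l + 1 + q" "\<lambda>j. j - (l + 1)"]) auto

context ellipsoid_testing
begin

lemma segment_enumeration:
  assumes D: "{1..D} \<subseteq> J" and a_le: "\<And>j. j \<in> {1..D} \<Longrightarrow> a j \<le> a D" and N: "l + N \<le> D"
  obtains e where "inj_on e {..<N}" "e ` {..<N} \<subseteq> J" "\<And>q. q < N \<Longrightarrow> a (e q) \<le> a D"
    "\<And>q. q < N \<Longrightarrow> \<sigma> (e q) = ordered_sd \<sigma> D (l + 1 + q)"
proof -
  obtain \<tau> where \<tau>: "bij_betw \<tau> {1..D} {1..D}" "\<And>j. j \<in> {1..D} \<Longrightarrow> ordered_sd \<sigma> D j = \<sigma> (\<tau> j)"
    by (rule ordered_sd_enumeration[where D=D and \<sigma>=\<sigma>]) blast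
  define e where "e q = \<tau> (l + 1 + q)" for q
  have range: "l + 1 + q \<in> {1..D}" if "q < N" for q using that N by simp
  have mem: "e q \<in> {1..D}" if "q < N" for q
    using bij_betwE[OF \<tau>(1)] range[OF that] by (auto simp: e_def)
  have "inj_on e {..<N}"
  proof (rule inj_onI)
    fix q r assume "q \<in> {..<N}" "r \<in> {..<N}" "e q = e r"
    then have "l + 1 + q = l + 1 + r"
      using inj_onD[OF bij_betw_imp_inj_on[OF \<tau>(1)], of "l + 1 + q" "l + 1 + r"] range
      by (simp add: e_def)
    then show "q = r" by simp
  qed
  moreover have "e ` {..<N} \<subseteq> J" using mem D by auto
  moreover have "a (e q) \<le> a D" if "q < N" for q using mem[OF that] by (rule a_le)
  moreover have "\<sigma> (e q) = ordered_sd \<sigma> D (l + 1 + q)" if "q < N" for q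
    using \<tau>(2)[OF range[OF that]] by (simp add: e_def)
  ultimately show thesis by (rule that)
qed

lemma ordered_sd_pos:
  assumes "{1..D} \<subseteq> J" "j \<in> {1..D}"
  shows "0 < ordered_sd \<sigma> D j"
proof -
  obtain \<tau> where \<tau>: "bij_betw \<tau> {1..D} {1..D}" "\<And>j. j \<in> {1..D} \<Longrightarrow> ordered_sd \<sigma> D j = \<sigma> (\<tau> j)"
    by (rule ordered_sd_enumeration[where D=D and \<sigma>=\<sigma>]) blast
  then have "\<tau> j \<in> J" using bij_betwE[OF \<tau>(1)] assms by blast
  then show ?thesis using \<tau>(2)[OF assms(2)] \<sigma>_pos by simp
qed

lemma rate_ge_of_short_segment:
  assumes D: "1 \<le> D" "{1..D} \<subseteq> J" "\<And>j. j \<in> {1..D} \<Longrightarrow> a j \<le> a D"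
    and m: "0 < m" "m \<le> N" "N \<le> 3 * m" "real m \<le> sqrt (real D)" and N: "l + N \<le> D"
    and v: "0 < v" "v \<le> sqrt (real D) powr (1 - 2 / p) * R\<^sup>2 / (a D)\<^sup>2"
      "v\<^sup>2 \<le> (\<Sum>j = l + 1..l + N. (ordered_sd \<sigma> D j) ^ 4)"
  shows "ereal (sqrt v) \<le> rate"
proof -
  obtain e where e: "inj_on e {..<N}" "e ` {..<N} \<subseteq> J" "\<And>q. q < N \<Longrightarrow> a (e q) \<le> a D"
    "\<And>q. q < N \<Longrightarrow> \<sigma> (e q) = ordered_sd \<sigma> D (l + 1 + q)"
    using segment_enumeration[OF D(2,3) N] by blast
  have "0 < a D" using D by (intro a_pos) auto
  then show ?thesis
  proof (rule rate_ge_of_short_blocks[OF e(1,2) _ e(3) m(1-3) _ m(4)])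
    have "(\<Sum>q<N. (\<sigma> (e q)) ^ 4) = (\<Sum>j = l + 1..l + N. (ordered_sd \<sigma> D j) ^ 4)"
      unfolding sum_segment by (intro sum.cong refl) (simp add: e(4))
    moreover have "sqrt v ^ 4 = v\<^sup>2"
      using v(1) power_mult[of "sqrt v" 2 2] by simp
    ultimately show "sqrt v ^ 4 \<le> (\<Sum>q<N. (\<sigma> (e q)) ^ 4)" using v(3) by simp
  qed (use v in auto)
qed

lemma rate_ge_of_long_segment:
  assumes D: "1 \<le> D" "{1..D} \<subseteq> J" "\<And>j. j \<in> {1..D} \<Longrightarrow> a j \<le> a D"
    and m: "0 < m" "3 * m \<le> N" "real m \<le> sqrt (real D)" and N: "l + N \<le> D"
    and v: "0 < v" "v \<le> sqrt (real D) powr (1 - 2 / p) * R\<^sup>2 / (a D)\<^sup>2"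
    and L: "0 \<le> L" "v\<^sup>2 \<le> L * (\<Sum>j = l + 1..l + m. (ordered_sd \<sigma> D j)\<^sup>2)\<^sup>2"
      "(real m)\<^sup>2 * L \<le> real N * (1 - L / 12)"
  shows "ereal (sqrt v) \<le> rate"
proof -
  obtain e where e: "inj_on e {..<N}" "e ` {..<N} \<subseteq> J" "\<And>q. q < N \<Longrightarrow> a (e q) \<le> a D"
    "\<And>q. q < N \<Longrightarrow> \<sigma> (e q) = ordered_sd \<sigma> D (l + 1 + q)"
    using segment_enumeration[OF D(2,3) N] by blast
  have "0 < a D" using D by (intro a_pos) auto
  then show ?thesis
  proof (rule rate_ge_of_long_blocks[OF e(1,2) _ e(3) _ m(1,2) _ m(3) _ L(1) _ L(3)])
    show "\<sigma> (e q) \<le> \<sigma> (e r)" if "q \<le> r" "r < N" for q r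
      using that N by (simp only: e(4) order.strict_trans1) (rule ordered_sd_mono, auto)
    have "(\<Sum>q<m. (\<sigma> (e q))\<^sup>2) = (\<Sum>j = l + 1..l + m. (ordered_sd \<sigma> D j)\<^sup>2)"
      unfolding sum_segment using m by (intro sum.cong refl) (simp add: e(4))
    moreover have "sqrt v ^ 4 = v\<^sup>2"
      using v(1) power_mult[of "sqrt v" 2 2] by simp
    ultimately show "sqrt v ^ 4 \<le> L * (\<Sum>q<m. (\<sigma> (e q))\<^sup>2)\<^sup>2" using L(2) by simp
  qed (use v in auto)
qed

text \<open>
  The \<open>k = \<lceil>sqrt D\<rceil>\<close> noisiest coordinates are dealt to \<open>k - 1\<close> blocks (one block if \<open>k = 1\<close>), so that
  the number of nonzero coordinates does not exceed \<open>sqrt D\<close>.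
\<close>

lemma rate_ge_r2:
  assumes D: "1 \<le> D" "{1..D} \<subseteq> J" "\<And>j. j \<in> {1..D} \<Longrightarrow> a j \<le> a D"
  shows "0 < r2 \<sigma> a p R D" "ereal (sqrt (r2 \<sigma> a p R D)) \<le> rate"
proof -
  define k where "k = ceil_sqrt D"
  note k = ceil_sqrt_bounds[OF D(1), folded k_def]
  let ?S = "\<Sum>j = D - k + 1..D - k + k. (ordered_sd \<sigma> D j) ^ 4"
  have kD: "D - k + k = D" using k(2) by simp
  have S: "0 < ?S"
    using k(1,2) by (intro sum_pos zero_less_power ordered_sd_pos[OF D(2)]) auto
  have aD: "0 < a D" using D by (intro a_pos) auto
  have r2: "r2 \<sigma> a p R D = min (sqrt (real D) powr (1 - 2 / p) * R\<^sup>2 / (a D)\<^sup>2) (sqrt ?S)"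
    by (simp only: r2_def k_def[symmetric] kD)
  show pos: "0 < r2 \<sigma> a p R D" unfolding r2 using S aD R D(1) by simp
  have "(r2 \<sigma> a p R D)\<^sup>2 \<le> (sqrt ?S)\<^sup>2" using pos by (intro power_mono) (simp_all add: r2)
  then have le: "(r2 \<sigma> a p R D)\<^sup>2 \<le> ?S" using S by simp
  have m: "0 < max 1 (k - 1)" "max 1 (k - 1) \<le> k" "k \<le> 3 * max 1 (k - 1)"
    "real (max 1 (k - 1)) \<le> sqrt (real D)"
    using k(1,5) D(1) by (auto simp: max_def)
  show "ereal (sqrt (r2 \<sigma> a p R D)) \<le> rate"
    using k(2) pos le by (intro rate_ge_of_short_segment[OF D m, of "D - k"]) (auto simp: r2)
qed

text \<open>
  Let \<open>n = D - l\<close>, let \<open>G\<close> be the sum of the first \<open>k\<close> of the \<open>n\<close> remaining variances and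
  \<open>t = ln (1 + sqrt (n / D))\<close>, so that the claimed rate is at most \<open>G t\<close>. If \<open>n \<le> 3 m\<close>, short
  blocks suffice: by Cauchy-Schwarz and monotonicity the sum of the \<open>\<sigma> ^ 4\<close> is at least
  \<open>n G\<^sup>2 / k\<^sup>2\<close>, which is at least \<open>(G t)\<^sup>2\<close>. If \<open>n > 3 m\<close>, the least noisy coordinate is
  discarded. The next \<open>m = k - 1\<close> variances sum to at least \<open>m G / k\<close>, because the discarded one
  is the smallest of the \<open>k\<close>. So the amplitudes relative to these variances grow at most by the
  factor \<open>k / m\<close> through the use of only \<open>m\<close> nonzero coordinates.
\<close>

lemma rate_ge_r1_term:
  assumes D: "1 \<le> D" "{1..D} \<subseteq> J" "\<And>j. j \<in> {1..D} \<Longrightarrow> a j \<le> a D"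
    and l: "l \<le> D - ceil_sqrt D"
  defines "v \<equiv> min (sqrt (real D) powr (1 - 2 / p) * R\<^sup>2 / (a D)\<^sup>2 *
               (Sigma_sq \<sigma> D l / Sigma_sq \<sigma> D (D - ceil_sqrt D))) (rho_sq \<sigma> D l)"
  shows "0 < v" "ereal (sqrt v) \<le> rate"
proof -
  define k where "k = ceil_sqrt D"
  note k = ceil_sqrt_bounds[OF D(1), folded k_def]
  define n where "n = D - l"
  define s where "s q = ordered_sd \<sigma> D (l + 1 + q)" for q
  define t where "t = ln (1 + sqrt (real n / real D))"
  define G where "G = (\<Sum>q<k. (s q)\<^sup>2)"
  have n: "k \<le> n" "n \<le> D" "l + n = D" using l k(2) by (auto simp: n_def k_def)
  have s_pos: "0 < s q" if "q < n" for q
    unfolding s_def using that n(3) by (intro ordered_sd_pos[OF D(2)]) auto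
  have s_mono: "s q \<le> s r" if "q \<le> r" "r < n" for q r
    unfolding s_def using that n(3) by (intro ordered_sd_mono) auto
  have G: "Sigma_sq \<sigma> D l = G"
    unfolding Sigma_sq_def G_def s_def k_def[symmetric] by (rule sum_segment)
  have Gpos: "0 < G" unfolding G_def using k(1) n(1) s_pos
    by (intro sum_pos zero_less_power) (auto simp: lessThan_empty_iff)
  have ratio: "1 - real l / real D = real n / real D"
    using D(1) n(3) by (simp add: field_simps flip: of_nat_add)
  have t0: "0 < t" unfolding t_def using D(1) k(1) n(1) by (intro ln_gt_zero) simp
  have rho: "rho_sq \<sigma> D l = G * t" by (simp add: rho_sq_def G ratio t_def)
  have top: "G \<le> Sigma_sq \<sigma> D (D - k)"
  proof -
    have "G \<le> (\<Sum>q<k. (ordered_sd \<sigma> D (D - k + 1 + q))\<^sup>2)"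
      unfolding G_def s_def using l k(2)
      by (intro sum_mono power_mono ordered_sd_mono less_imp_le[OF ordered_sd_pos[OF D(2)]])
        (auto simp: k_def[symmetric])
    also have "\<dots> = Sigma_sq \<sigma> D (D - k)"
      unfolding Sigma_sq_def k_def[symmetric] by (rule sum_segment[symmetric])
    finally show ?thesis .
  qed
  define C where "C = sqrt (real D) powr (1 - 2 / p) * R\<^sup>2 / (a D)\<^sup>2"
  have aD: "0 < a D" using D by (intro a_pos) auto
  have C: "0 < C" unfolding C_def using aD R D(1) by simp
  have v: "v = min (C * (G / Sigma_sq \<sigma> D (D - k))) (G * t)"
    unfolding v_def rho G k_def[symmetric] C_def ..
  show vpos: "0 < v" unfolding v using C Gpos top t0 by simp
  have "C * (G / Sigma_sq \<sigma> D (D - k)) \<le> C * 1"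
    using C Gpos top by (intro mult_left_mono) auto
  then have vC: "v \<le> sqrt (real D) powr (1 - 2 / p) * R\<^sup>2 / (a D)\<^sup>2"
    unfolding v C_def[symmetric] by simp
  have vG: "v\<^sup>2 \<le> G\<^sup>2 * t\<^sup>2"
    using vpos power_mono[of v "G * t" 2] by (simp add: v power_mult_distrib)
  define m where "m = max 1 (k - 1)"
  have m: "0 < m" "m \<le> k" "real m \<le> sqrt (real D)"
    using k(1,5) D(1) by (auto simp: m_def max_def)
  show "ereal (sqrt v) \<le> rate"
  proof (cases "n \<le> 3 * m")
    case True
    have "(real n * G)\<^sup>2 \<le> (real k)\<^sup>2 * (real n * (\<Sum>q<n. (s q) ^ 4))"
    proof -
      have "real n * G \<le> real k * (\<Sum>q<n. (s q)\<^sup>2)"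
      proof -
        \<comment> \<open>The first \<open>k\<close> variances have mean \<open>G / k\<close>, and none of the others is below that mean.\<close>
        have Gk: "G \<le> real k * (s (k - 1))\<^sup>2"
        proof -
          have "G \<le> (\<Sum>q<k. (s (k - 1))\<^sup>2)"
            unfolding G_def using n(1) s_pos s_mono
            by (intro sum_mono power_mono) (auto simp: less_imp_le)
          then show ?thesis by simp
        qed
        have "real (n - k) * (s (k - 1))\<^sup>2 = (\<Sum>q\<in>{k..<n}. (s (k - 1))\<^sup>2)" by simp
        also have "\<dots> \<le> (\<Sum>q\<in>{k..<n}. (s q)\<^sup>2)"
          using k(1) n(1) s_pos[of "k - 1"] s_mono
          by (intro sum_mono power_mono) (auto simp: less_imp_le)
        finally have rest: "real (n - k) * (s (k - 1))\<^sup>2 \<le> (\<Sum>q\<in>{k..<n}. (s q)\<^sup>2)" .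
        have "real n * G = real k * G + real (n - k) * G"
          using n(1) by (simp add: of_nat_diff algebra_simps)
        also have "\<dots> \<le> real k * G + real (n - k) * (real k * (s (k - 1))\<^sup>2)"
          using Gk by (intro add_left_mono mult_left_mono) auto
        also have "\<dots> = real k * (G + real (n - k) * (s (k - 1))\<^sup>2)"
          by (simp add: algebra_simps)
        also have "\<dots> \<le> real k * (G + (\<Sum>q\<in>{k..<n}. (s q)\<^sup>2))"
          using rest by (intro mult_left_mono add_left_mono) auto
        also have "G + (\<Sum>q\<in>{k..<n}. (s q)\<^sup>2) = (\<Sum>q<n. (s q)\<^sup>2)"
          using sum.atLeastLessThan_concat[of 0 k n "\<lambda>q. (s q)\<^sup>2"] n(1)
          by (simp add: G_def atLeast0LessThan)
        finally show ?thesis .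
      qed
      then have "(real n * G)\<^sup>2 \<le> (real k * (\<Sum>q<n. (s q)\<^sup>2))\<^sup>2"
        using Gpos by (intro power_mono) auto
      also have "\<dots> = (real k)\<^sup>2 * (\<Sum>q<n. 1 * (s q)\<^sup>2)\<^sup>2" by (simp add: power_mult_distrib)
      also have "\<dots> \<le> (real k)\<^sup>2 * ((\<Sum>q<n. 1\<^sup>2) * (\<Sum>q<n. ((s q)\<^sup>2)\<^sup>2))"
        by (intro mult_left_mono Cauchy_Schwarz_ineq_sum) auto
      also have "\<dots> = (real k)\<^sup>2 * (real n * (\<Sum>q<n. (s q) ^ 4))"
        by (simp flip: power_mult)
      finally show ?thesis .
    qed
    moreover have npos: "0 < real n" using k(1) n(1) by simp
    ultimately have nG: "real n * G\<^sup>2 \<le> (real k)\<^sup>2 * (\<Sum>q<n. (s q) ^ 4)"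
      by (simp add: power2_eq_square mult_ac)
    have "real n * (G\<^sup>2 * t\<^sup>2) \<le> (real k)\<^sup>2 * (\<Sum>q<n. (s q) ^ 4) * t\<^sup>2"
      using mult_right_mono[OF nG, of "t\<^sup>2"] by (simp add: mult_ac)
    also have "\<dots> = ((real k)\<^sup>2 * t\<^sup>2) * (\<Sum>q<n. (s q) ^ 4)" by simp
    also have "\<dots> \<le> real n * (\<Sum>q<n. (s q) ^ 4)"
      unfolding t_def using k(1,4) n s_pos
      by (intro mult_right_mono sq_ceil_sqrt_times_ln_le sum_nonneg) (auto simp: less_imp_le)
    finally have "G\<^sup>2 * t\<^sup>2 \<le> (\<Sum>q<n. (s q) ^ 4)" using npos by simp
    also have "\<dots> = (\<Sum>j = l + 1..l + n. (ordered_sd \<sigma> D j) ^ 4)"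
      unfolding sum_segment s_def ..
    finally have "v\<^sup>2 \<le> (\<Sum>j = l + 1..l + n. (ordered_sd \<sigma> D j) ^ 4)" using vG by simp
    then show ?thesis
      using n m True vpos vC by (intro rate_ge_of_short_segment[OF D m(1) _ True m(3), of l]) auto
  next
    case False
    \<comment> \<open>For \<open>k = 1\<close> one has \<open>D = 1\<close>, which belongs to the case of short blocks.\<close>
    have k2: "2 \<le> k"
    proof (rule ccontr)
      assume "\<not> 2 \<le> k"
      then have "D \<le> 1" using k(1,3) by (cases "k = 1") auto
      then show False using False n(2) by (simp add: m_def)
    qed
    then have km: "k = Suc m" by (simp add: m_def)
    define H where "H = (\<Sum>q<m. (s (Suc q))\<^sup>2)"
    define L where "L = ((real m + 1) / real m)\<^sup>2 * t\<^sup>2"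
    have GH: "G = (s 0)\<^sup>2 + H"
      unfolding G_def H_def km by (rule sum.lessThan_Suc_shift)
    have H0: "real m * (s 0)\<^sup>2 \<le> H"
    proof -
      have "(\<Sum>q<m. (s 0)\<^sup>2) \<le> H" unfolding H_def
        using n(1) km s_pos[of 0] s_mono by (intro sum_mono power_mono) (auto simp: less_imp_le)
      then show ?thesis by simp
    qed
    have "G \<le> (real m + 1) / real m * H"
      using H0 m(1) by (simp add: GH field_simps)
    then have "G\<^sup>2 \<le> ((real m + 1) / real m * H)\<^sup>2" using Gpos by (intro power_mono) auto
    then have "G\<^sup>2 * t\<^sup>2 \<le> ((real m + 1) / real m * H)\<^sup>2 * t\<^sup>2" by (rule mult_right_mono) simp
    also have "\<dots> = L * H\<^sup>2" unfolding L_def power_mult_distrib by (simp only: mult_ac)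
    finally have "v\<^sup>2 \<le> L * H\<^sup>2" using vG by simp
    also have "H = (\<Sum>j = (l + 1) + 1..(l + 1) + m. (ordered_sd \<sigma> D j)\<^sup>2)"
      unfolding sum_segment H_def s_def by simp
    finally have vL: "v\<^sup>2 \<le> L * (\<Sum>j = (l + 1) + 1..(l + 1) + m. (ordered_sd \<sigma> D j)\<^sup>2)\<^sup>2" .
    have "(real m)\<^sup>2 * L \<le> real (n - 1) * (1 - L / 12)"
      unfolding L_def t_def using m(1) k(4) km False n(2) by (intro long_block_condition) auto
    then show ?thesis
      using False n(3) vL vpos vC
      by (intro rate_ge_of_long_segment[OF D m(1) _ m(3), of "n - 1" "l + 1"]) (auto simp: L_def)
  qed
qed

lemma rate_ge_r1:
  assumes D: "1 \<le> D" "{1..D} \<subseteq> J" "\<And>j. j \<in> {1..D} \<Longrightarrow> a j \<le> a D"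
  shows "0 < r1 \<sigma> a p R D" "ereal (sqrt (r1 \<sigma> a p R D)) \<le> rate"
proof -
  let ?f = "\<lambda>l. min (sqrt (real D) powr (1 - 2 / p) * R\<^sup>2 / (a D)\<^sup>2 *
               (Sigma_sq \<sigma> D l / Sigma_sq \<sigma> D (D - ceil_sqrt D))) (rho_sq \<sigma> D l)"
  have "r1 \<sigma> a p R D \<in> ?f ` {0..D - ceil_sqrt D}"
    unfolding r1_def by (rule Max_in) auto
  then obtain l where l: "l \<le> D - ceil_sqrt D" "r1 \<sigma> a p R D = ?f l" by auto
  show "0 < r1 \<sigma> a p R D" unfolding l(2) by (rule rate_ge_r1_term(1)[OF D l(1)])
  show "ereal (sqrt (r1 \<sigma> a p R D)) \<le> rate" unfolding l(2) by (rule rate_ge_r1_term(2)[OF D l(1)])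
qed

end

lemma ereal_le_square_of_sqrt_le:
  assumes "0 < v" "ereal (sqrt v) \<le> x"
  shows "ereal v \<le> x\<^sup>2"
proof -
  have "ereal v = ereal (sqrt v) * ereal (sqrt v)" using assms(1) by simp
  also have "\<dots> \<le> x * x" using assms by (intro ereal_mult_mono) (auto intro: order_trans[rotated])
  finally show ?thesis by (simp add: power2_eq_square)
qed

theorem theorem3:
  fixes J :: "nat set" and \<sigma> a :: "nat \<Rightarrow> real" and \<alpha> \<beta> p R :: real
  assumes "(\<exists>N\<ge>1. J = {1..N}) \<or> J = {1..}"
    and "\<And>j. j \<in> J \<Longrightarrow> \<sigma> j > 0"
    and "0 < \<alpha>" and "\<alpha> < 1"
    and "0 < \<beta>" and "\<beta> < 1 - \<alpha>"
    and "\<alpha> + \<beta> \<le> 0.59"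
    and "0 < p" and "p < 2"
    and "R > 0"
    and "\<And>j. j \<in> J \<Longrightarrow> a j > 0"
    and "mono_on J a"
  shows "(minimax_rate J \<sigma> (lp_ellipsoid J a p R) \<alpha> \<beta>)\<^sup>2
           \<ge> (SUP D\<in>J. ereal (max (r1 \<sigma> a p R D) (r2 \<sigma> a p R D)))"
proof (rule SUP_least)
  fix D assume DJ: "D \<in> J"
  interpret ellipsoid_testing J \<sigma> a \<alpha> \<beta> p R
    by unfold_locales (use assms in auto)
  have D: "1 \<le> D" "{1..D} \<subseteq> J" using assms(1) DJ by auto
  have mono: "a j \<le> a D" if "j \<in> {1..D}" for j
    using mono_onD[OF assms(12)] D(2) DJ that by auto
  note le1 = ereal_le_square_of_sqrt_le[OF rate_ge_r1[OF D mono]]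
  note le2 = ereal_le_square_of_sqrt_le[OF rate_ge_r2[OF D mono]]
  show "ereal (max (r1 \<sigma> a p R D) (r2 \<sigma> a p R D)) \<le> rate\<^sup>2"
    using le1 le2 by (simp add: max_def)
qed

end
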